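(* Let $\alpha>2$, $\theta>0$ and an integer $K\ge 0$ be fixed, and consider the cellular network described in the context with zero noise, $\sigma^2=0$ (interference-limited network). Then the outage probability $$P_{\mathsf{out}}=\Pr\left(\frac{p|U_0|^{-\alpha}}{I}<\theta\right),\qquad I=\sum_{Y\in\Phi\setminus(\{Y_0\}\cup\mathcal{C})}p|U_Y|^{-\alpha},$$ does not depend on the base-station density $\lambda_b>0$ nor on the mobile-transmission power $p>0$.
   Context: Cellular (uplink) network model: base stations form a homogeneous Poisson point process on $\mathbb{R}^2$ with density $\lambda_b$. Considered from a typical base station $Y_0$ located at the origin (Palm version), the process $\Phi=\Phi(\lambda_b)$ consists of the point $Y_0=0$ together with a homogeneous Poisson point process of density $\lambda_b$ on $\mathbb{R}^2$. The Voronoi cells of the points of $\Phi$ partition the plane. Each base station $Y\in\Phi$ serves exactly one active mobile $U_Y$; given $\Phi$, the mobiles $U_Y$ are independent and $U_Y$ is uniformly distributed in the Voronoi cell of $Y$. Write $U_0=U_{Y_0}$. Let $K\ge 0$ be a fixed integer and let $\mathcal{C}\subset\Phi\setminus\{Y_0\}$ be the set of the $K$ base stations whose active mobiles are the $K$ interfering mobiles ($U_Y$ with $Y\ne Y_0$) nearest to $Y_0$; their interference at $Y_0$ is perfectly canceled. All mobiles transmit with power $p$, and a signal sent with power $a$ by a mobile $U$ is received at a base station $Y$ with power $a|U-Y|^{-\alpha}$. *)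

theory Defs
  imports "HOL-Probability.Probability"
begin

definition locally_finite :: "'b::metric_space set \<Rightarrow> bool" where
  "locally_finite S \<longleftrightarrow> (\<forall>B. bounded B \<longrightarrow> finite (S \<inter> B))"

definition point_process :: "'a measure \<Rightarrow> ('a \<Rightarrow> 'b::euclidean_space set) \<Rightarrow> bool" where
  "point_process M S \<longleftrightarrow>
     (\<forall>\<omega>\<in>space M. locally_finite (S \<omega>)) \<and>
     (\<forall>B\<in>sets borel. bounded B \<longrightarrow> (\<lambda>\<omega>. card (S \<omega> \<inter> B)) \<in> M \<rightarrow>\<^sub>M count_space UNIV)"

(* The Poisson law is written out because poisson_pmf is only specified for a positive rate,
   whereas bounded Borel sets may be null. *)
definition homogeneous_poisson_process ::
    "'a measure \<Rightarrow> real \<Rightarrow> ('a \<Rightarrow> 'b::euclidean_space set) \<Rightarrow> bool" where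
  "homogeneous_poisson_process M l S \<longleftrightarrow>
     point_process M S \<and>
     (\<forall>B\<in>sets borel. bounded B \<longrightarrow>
        (\<forall>n. \<P>(\<omega> in M. card (S \<omega> \<inter> B) = n)
              = (l * measure lborel B) ^ n / fact n * exp (- (l * measure lborel B)))) \<and>
     (\<forall>\<B>. finite \<B> \<longrightarrow> disjoint \<B> \<longrightarrow> (\<forall>B\<in>\<B>. B \<in> sets borel \<and> bounded B) \<longrightarrow>
        prob_space.indep_vars M (\<lambda>_. count_space UNIV) (\<lambda>B \<omega>. card (S \<omega> \<inter> B)) \<B>)"

(* The sub-sigma-algebra of M generated by the point process S. *)
definition process_algebra :: "'a measure \<Rightarrow> ('a \<Rightarrow> 'b::euclidean_space set) \<Rightarrow> 'a measure" where
  "process_algebra M S =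
     sigma (space M) {{\<omega>\<in>space M. card (S \<omega> \<inter> B) = n} | B n. B \<in> sets borel \<and> bounded B}"

definition voronoi_cell :: "'b::metric_space set \<Rightarrow> 'b \<Rightarrow> 'b set" where
  "voronoi_cell S y = {u. \<forall>z\<in>S. dist u y \<le> dist u z}"

(* A point of S selected measurably as a function of S alone. *)
definition selection ::
    "'a measure \<Rightarrow> ('a \<Rightarrow> 'b::euclidean_space set) \<Rightarrow> ('a \<Rightarrow> 'b) \<Rightarrow> bool" where
  "selection M S Y \<longleftrightarrow>
     Y \<in> borel_measurable (process_algebra M S) \<and> (\<forall>\<omega>\<in>space M. Y \<omega> \<in> S \<omega>)"

(* U \<omega> y is the mobile served by y; it is only meaningful for y in S \<omega>.  Since the points of S are
   random, the conditional law of the mobiles given S is expressed along finitely many selected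
   points Y 0, ..., Y (n-1): wherever these are distinct, the conditional probability given S that
   the mobile of Y i is in A i for all i < n is the product of the uniform probabilities. *)
definition independent_uniform_mobiles ::
    "'a measure \<Rightarrow> ('a \<Rightarrow> 'b::euclidean_space set) \<Rightarrow> ('a \<Rightarrow> 'b \<Rightarrow> 'b) \<Rightarrow> bool" where
  "independent_uniform_mobiles M S U \<longleftrightarrow>
     (\<forall>Y. selection M S Y \<longrightarrow> (\<lambda>\<omega>. U \<omega> (Y \<omega>)) \<in> borel_measurable M) \<and>
     (\<forall>(n::nat) Y A. (\<forall>i<n. selection M S (Y i) \<and> A i \<in> sets borel) \<longrightarrow>
        (AE \<omega> in M. inj_on (\<lambda>i. Y i \<omega>) {..<n} \<longrightarrow>
           real_cond_exp M (process_algebra M S)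
               (indicator {\<omega>'\<in>space M. \<forall>i<n. U \<omega>' (Y i \<omega>') \<in> A i}) \<omega>
             = (\<Prod>i<n. measure (uniform_measure lborel (voronoi_cell (S \<omega>) (Y i \<omega>))) (A i))))"

(* The Palm version seen from the base station at the origin: P is the Poisson process of the other
   base stations, and the full set of base stations is insert 0 (P \<omega>). *)
locale cellular_network = prob_space M
  for M :: "'a measure" +
  fixes l :: real
    and P :: "'a \<Rightarrow> (real^2) set"
    and U :: "'a \<Rightarrow> real^2 \<Rightarrow> real^2"
  assumes density_pos: "l > 0"
    and poisson: "homogeneous_poisson_process M l P"
    and mobiles: "independent_uniform_mobiles M (\<lambda>\<omega>. insert 0 (P \<omega>)) U"

(* The K elements of S with the smallest values of d; see K_nearest_characterization.
   With ties (a null event for the mobiles) all tied elements are included. *)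
definition K_nearest :: "nat \<Rightarrow> ('b \<Rightarrow> real) \<Rightarrow> 'b set \<Rightarrow> 'b set" where
  "K_nearest K d S = {y\<in>S. finite {z\<in>S. d z < d y} \<and> card {z\<in>S. d z < d y} < K}"

lemma K_nearest_characterization:
  assumes fin: "\<And>r. finite {z\<in>S. d z \<le> r}" and inj: "inj_on d S"
    and size: "infinite S \<or> K \<le> card S"
  shows "C = K_nearest K d S \<longleftrightarrow>
         C \<subseteq> S \<and> finite C \<and> card C = K \<and> (\<forall>y\<in>C. \<forall>z\<in>S - C. d y < d z)" (is "_ \<longleftrightarrow> ?Q K C")
proof -
  have ex: "\<exists>C. ?Q K C" using size
  proof (induction K)
    case 0
    show ?case by (intro exI[of _ "{}"]) auto
  next
    case (Suc K)
    then obtain C where C: "?Q K C" by (metis Suc_leD)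
    have "S - C \<noteq> {}"
    proof
      assume "S - C = {}"
      with C have "S = C" by blast
      with C Suc.prems show False by auto
    qed
    then obtain a where a: "a \<in> S - C" by blast
    let ?T = "{z\<in>S - C. d z \<le> d a}"
    have T: "finite ?T" by (rule finite_subset[OF _ fin[of "d a"]]) blast
    have "a \<in> ?T" using a by simp
    then have T': "?T \<noteq> {}" by (metis empty_iff)
    obtain m where m: "m \<in> ?T" "Min (d ` ?T) = d m"
      by (rule obtains_MIN[OF T T', of d])
    have min: "d m \<le> d z" if "z \<in> ?T" for z
      unfolding m(2)[symmetric] using T that by (intro Min_le) auto
    have "d m < d z" if z: "z \<in> S - insert m C" for z
    proof -
      have "d m \<le> d z" using min[of z] m(1) z by (cases "d z \<le> d a") auto
      moreover have "d m \<noteq> d z" using inj_onD[OF inj, of m z] m(1) z by auto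
      ultimately show ?thesis by simp
    qed
    then have "?Q (Suc K) (insert m C)" using C m(1) by auto
    then show ?case by blast
  qed
  have eq: "C = K_nearest K d S" if C: "?Q K C" for C
  proof (intro set_eqI iffI)
    fix y assume y: "y \<in> C"
    have "{z\<in>S. d z < d y} \<subset> C" using C y by (auto simp: not_less dest: less_asym)
    then have "finite {z\<in>S. d z < d y} \<and> card {z\<in>S. d z < d y} < K"
      using C psubset_card_mono finite_subset by (metis psubset_imp_subset)
    then show "y \<in> K_nearest K d S" using C y by (auto simp: K_nearest_def)
  next
    fix y assume y: "y \<in> K_nearest K d S"
    show "y \<in> C"
    proof (rule ccontr)
      assume "y \<notin> C"
      then have "C \<subseteq> {z\<in>S. d z < d y}" using C y by (auto simp: K_nearest_def)
      then have "K \<le> card {z\<in>S. d z < d y}"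
        using C y card_mono[of "{z\<in>S. d z < d y}" C] by (auto simp: K_nearest_def)
      with y show False by (auto simp: K_nearest_def)
    qed
  qed
  show ?thesis using ex eq by metis
qed

(* u y is the mobile of station y.  Values are extended nonnegative reals, so the sum always
   exists. *)
definition interference ::
    "real \<Rightarrow> real \<Rightarrow> nat \<Rightarrow> (real^2) set \<Rightarrow> (real^2 \<Rightarrow> real^2) \<Rightarrow> ennreal" where
  "interference \<alpha> p K S u =
     (\<Sum>\<^sub>\<infinity>y\<in>S - ({0} \<union> K_nearest K (\<lambda>y. norm (u y)) (S - {0})). ennreal (p * norm (u y) powr - \<alpha>))"

definition outage_probability ::
    "'a measure \<Rightarrow> ('a \<Rightarrow> (real^2) set) \<Rightarrow> ('a \<Rightarrow> real^2 \<Rightarrow> real^2) \<Rightarrow>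
     real \<Rightarrow> real \<Rightarrow> nat \<Rightarrow> real \<Rightarrow> real" where
  "outage_probability M P U \<alpha> \<theta> K p =
     \<P>(\<omega> in M. ennreal (p * norm (U \<omega> 0) powr - \<alpha>)
                 / interference \<alpha> p K (insert 0 (P \<omega>)) (U \<omega>) < ennreal \<theta>)"

end

theory Submission
  imports Defs
begin

text \<open>Scaling the plane by \<open>c\<close> turns a network of density \<open>l\<close> into one of density \<open>l / c\<^sup>2\<close> and
  multiplies all received powers by \<open>c powr - \<alpha>\<close>. A common factor of all powers, such as \<open>p\<close>, cancels
  in the signal-to-interference ratio, so it suffices to compare two networks of density 1 with
  transmission power 1, possibly on different probability spaces.

  A countable family of bounded Borel sets that isolates the points of every locally finite set
  enumerates the stations, measurably in their counts. The finite-dimensional Poisson laws determine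
  the law of this enumeration, and the conditional law of the mobiles given the stations then
  determines the law of the sequence of the mobiles of the enumerated stations. The outage event is a
  measurable function of this sequence, since almost surely there are infinitely many stations, all
  enumerated once.\<close>

subsection \<open>Outage under scaling\<close>

lemma infsum_cmult_ennreal: "(\<Sum>\<^sub>\<infinity>x\<in>A. c * f x) = c * (\<Sum>\<^sub>\<infinity>x\<in>A. f x :: ennreal)"
  by (simp add: nonneg_infsum_complete SUP_mult_left_ennreal sum_distrib_left)

lemma infsum_nat_eq_suminf: "infsum f A = (\<Sum>n. if n \<in> A then f n else 0 :: ennreal)" for A :: "nat set"
proof -
  let ?g = "\<lambda>n. if n \<in> A then f n else 0"
  have "infsum f A = infsum ?g UNIV"
    by (rule infsum_cong_neutral) auto
  moreover have "?g summable_on UNIV"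
    by (rule nonneg_summable_on_complete) auto
  ultimately show ?thesis
    using has_sum_infsum has_sum_imp_sums sums_unique by metis
qed

text \<open>Whether an element is among the \<open>K\<close> nearest depends only on how many
  elements are nearer, and an injective renaming keeps this number. The renaming is the scaling map
  in one use and the enumeration of the stations in the other.\<close>

lemma K_nearest_image:
  assumes "inj_on e T"
  shows "K_nearest K d (e ` T) = e ` K_nearest K (d \<circ> e) T"
proof -
  have "{z \<in> e ` T. d z < r} = e ` {z\<in>T. (d \<circ> e) z < r}" for r
    by auto
  moreover have "inj_on e {z\<in>T. (d \<circ> e) z < r}" for r
    using assms by (rule inj_on_subset) auto
  ultimately show ?thesis
    unfolding K_nearest_def by (auto simp: card_image finite_image_iff)
qed

text \<open>Serves measurability: a bound on the size of a random set becomes countably many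
  conditions on finite sums.\<close>

lemma finite_card_less_iff_initial_segments:
  fixes X :: "nat set"
  shows "finite X \<and> card X < K \<longleftrightarrow> (\<forall>N. (\<Sum>m<N. of_bool (m \<in> X)) < K)"
proof -
  have eq: "(\<Sum>m<N. of_bool (m \<in> X)) = card (X \<inter> {..<N})" for N
    by (simp add: sum.If_cases of_bool_def Int_commute)
  show ?thesis unfolding eq
  proof safe
    fix N assume "finite X" "card X < K"
    then show "card (X \<inter> {..<N}) < K"
      by (meson card_mono inf_le1 le_less_trans)
  next
    assume *: "\<forall>N. card (X \<inter> {..<N}) < K"
    show fin: "finite X"
    proof (rule ccontr)
      assume "infinite X"
      then obtain F where F: "F \<subseteq> X" "finite F" "card F = K"
        using infinite_arbitrarily_large by blast
      then obtain N where "F \<subseteq> {..<N}"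
        using finite_nat_bounded by blast
      then have "F \<subseteq> X \<inter> {..<N}" using F by auto
      then have "card F \<le> card (X \<inter> {..<N})"
        by (intro card_mono) auto
      with * F show False by (metis not_le)
    qed
    obtain N where "X \<subseteq> {..<N}"
      using finite_nat_bounded[OF fin] by blast
    then have "X \<inter> {..<N} = X" by auto
    with * show "card X < K" by metis
  qed
qed

definition outage :: "real \<Rightarrow> real \<Rightarrow> nat \<Rightarrow> real \<Rightarrow> (real^2) set \<Rightarrow> (real^2 \<Rightarrow> real^2) \<Rightarrow> bool" where
  "outage \<alpha> \<theta> K p S u \<longleftrightarrow>
     ennreal (p * norm (u 0) powr - \<alpha>) / interference \<alpha> p K S u < ennreal \<theta>"

lemma outage_probability_eq:
  "outage_probability M P U \<alpha> \<theta> K p = \<P>(\<omega> in M. outage \<alpha> \<theta> K p (insert 0 (P \<omega>)) (U \<omega>))"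
  by (simp add: outage_probability_def outage_def)

text \<open>The power is a common factor of signal and interference. It is neither 0 nor infinite,
  so it cancels in \<open>ennreal\<close> whatever the interference, including 0 and
  \<infinity>.\<close>

lemma outage_power:
  assumes "p > 0"
  shows "outage \<alpha> \<theta> K p S u \<longleftrightarrow> outage \<alpha> \<theta> K 1 S u"
proof -
  have p: "ennreal (p * norm x powr - \<alpha>) = ennreal p * ennreal (norm x powr - \<alpha>)" for x :: "real^2"
    using assms by (simp add: ennreal_mult)
  have "(ennreal p * a) / (ennreal p * b) = a / b" for a b
    using assms divide_mult_eq[of "ennreal p" a b] by (simp add: mult.commute)
  then show ?thesis
    by (simp add: outage_def interference_def infsum_cmult_ennreal p)
qed

text \<open>Scaling multiplies all distances of mobiles from the origin by \<open>c\<close>. Their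
  order, and hence the canceled set, stays the same, and the common factor
  \<open>c powr - \<alpha>\<close> of the received powers can be read as a change of the
  transmission power.\<close>

lemma outage_scale:
  assumes "c > 0" "p > 0"
  shows "outage \<alpha> \<theta> K p ((*\<^sub>R) c ` S) (\<lambda>y. c *\<^sub>R u (y /\<^sub>R c)) \<longleftrightarrow> outage \<alpha> \<theta> K p S u"
proof -
  let ?v = "\<lambda>y. c *\<^sub>R u (y /\<^sub>R c)" and ?s = "(*\<^sub>R) c :: real^2 \<Rightarrow> real^2"
  have inj: "inj ?s"
    using assms by (auto simp: inj_on_def)
  have inj': "inj_on ?s T" for T
    using inj by (rule inj_on_subset) simp
  have s: "?s y /\<^sub>R c = y" for y
    using assms by simp
  have norm: "norm (c *\<^sub>R x) = c * norm x" for x :: "real^2"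
    using assms by simp
  have diff: "?s ` A - {0} = ?s ` (A - {0})" for A
    by (simp add: image_set_diff[OF inj])
  have near: "K_nearest K (\<lambda>y. c * norm (u y)) T = K_nearest K (\<lambda>y. norm (u y)) T" for T
    using assms by (simp add: K_nearest_def)
  have comp: "(\<lambda>y. norm (?v y)) \<circ> ?s = (\<lambda>y. c * norm (u y))"
    using assms by (simp add: fun_eq_iff)
  have far: "?s ` S - ({0} \<union> K_nearest K (\<lambda>y. norm (?v y)) (?s ` S - {0})) =
      ?s ` (S - ({0} \<union> K_nearest K (\<lambda>y. norm (u y)) (S - {0})))"
    unfolding diff K_nearest_image[OF inj'] comp near
    by (simp add: image_set_diff[OF inj] image_Un)
  have power: "p * norm (c *\<^sub>R x) powr - \<alpha> = (p * c powr - \<alpha>) * norm x powr - \<alpha>" for x :: "real^2"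
    unfolding norm using assms by (simp add: powr_mult)
  have v0: "?v 0 = c *\<^sub>R u 0"
    by simp
  have "outage \<alpha> \<theta> K p (?s ` S) ?v \<longleftrightarrow> outage \<alpha> \<theta> K (p * c powr - \<alpha>) S u"
    unfolding outage_def interference_def far infsum_reindex[OF inj'] o_def s v0 power ..
  also have "\<dots> \<longleftrightarrow> outage \<alpha> \<theta> K p S u"
    using assms outage_power[of p] outage_power[of "p * c powr - \<alpha>"] by simp
  finally show ?thesis .
qed

subsection \<open>Enumerating the range of a sequence\<close>

text \<open>Once a finite range is exhausted, \<open>LEAST\<close> is applied to an empty predicate: the remaining
  values are unspecified, but they still lie in the range.\<close>
function dedup :: "(nat \<Rightarrow> 'b) \<Rightarrow> nat \<Rightarrow> 'b" where
  "dedup y n = y (LEAST k. \<forall>j\<in>{..<n}. y k \<noteq> dedup y j)"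
  by auto
termination by (relation "Wellfounded.measure snd") auto

declare dedup.simps [simp del]

lemma dedup_0: "dedup y 0 = y 0"
proof -
  have "dedup y 0 = y (LEAST k. \<forall>j\<in>{..<0}. y k \<noteq> dedup y j)"
    by (rule dedup.simps)
  then show ?thesis by (simp add: Least_eq_0)
qed

text \<open>While some term of \<open>y\<close> is still missing, \<open>LEAST\<close> picks the
  missing term of smallest index. The bound \<open>i \<le> k\<close> is what later confines the
  values to finitely many terms.\<close>

lemma dedup_new:
  assumes "y k \<notin> dedup y ` {..<n}"
  obtains i where "i \<le> k" "dedup y n = y i" "y i \<notin> dedup y ` {..<n}"
proof
  let ?Q = "\<lambda>i. \<forall>j\<in>{..<n}. y i \<noteq> dedup y j"
  have k: "?Q k" using assms by blast
  show "(LEAST i. ?Q i) \<le> k" using k by (rule Least_le)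
  show "dedup y n = y (LEAST i. ?Q i)" by (rule dedup.simps)
  have "?Q (LEAST i. ?Q i)" using k by (rule LeastI[of ?Q])
  then show "y (LEAST i. ?Q i) \<notin> dedup y ` {..<n}" by blast
qed

lemma inj_if_new:
  assumes "\<And>n::nat. f n \<notin> f ` {..<n}"
  shows "inj f"
proof (rule linorder_injI)
  fix m n :: nat assume "m < n"
  then have "f m \<in> f ` {..<n}" by simp
  with assms[of n] show "f m \<noteq> f n" by metis
qed

text \<open>Before stage \<open>n\<close> only finitely many values are used up, so an infinite
  range always leaves a new one.\<close>

lemma inj_dedup:
  assumes "infinite (range y)"
  shows "inj (dedup y)"
proof (rule inj_if_new)
  fix n
  have "finite (dedup y ` {..<n})" by simp
  with assms have "\<not> range y \<subseteq> dedup y ` {..<n}"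
    by (metis finite_subset)
  then obtain k where "y k \<notin> dedup y ` {..<n}"
    by blast
  then show "dedup y n \<notin> dedup y ` {..<n}"
    by (rule dedup_new) metis
qed

text \<open>If \<open>y k\<close> were never listed, each stage would choose a new value among the
  terms of index at most \<open>k\<close>. This would give infinitely many distinct values in a
  finite set.\<close>

lemma range_dedup: "range (dedup y) = range y"
proof
  show "range (dedup y) \<subseteq> range y"
  proof (rule image_subsetI)
    fix n
    have "dedup y n = y (LEAST k. \<forall>j\<in>{..<n}. y k \<noteq> dedup y j)"
      by (rule dedup.simps)
    then show "dedup y n \<in> range y"
      by (rule range_eqI)
  qed
  show "range y \<subseteq> range (dedup y)"
  proof (rule ccontr)
    assume "\<not> range y \<subseteq> range (dedup y)"
    then obtain k where "y k \<notin> range (dedup y)" by blast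
    then have k: "y k \<notin> dedup y ` {..<n}" for n by blast
    have "dedup y n \<notin> dedup y ` {..<n}" for n
      using k[of n] by (rule dedup_new) metis
    then have "inj (dedup y)" by (rule inj_if_new)
    moreover have "dedup y n \<in> y ` {..k}" for n
      using k[of n] by (rule dedup_new) (metis atMost_iff imageI)
    then have "range (dedup y) \<subseteq> y ` {..k}"
      by (rule image_subsetI)
    then have "finite (range (dedup y))"
      by (rule finite_subset) simp
    ultimately show False
      using finite_imageD infinite_UNIV_nat by metis
  qed
qed

text \<open>By strong induction the chosen index is a measurable function into the naturals, and
  evaluation of a sequence at such an index is measurable.\<close>

lemma measurable_dedup [measurable]:
  "(\<lambda>y. dedup y n :: 'b::{second_countable_topology, t2_space}) \<in> borel_measurable (\<Pi>\<^sub>M i\<in>UNIV. borel)"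
proof (induction n rule: less_induct)
  case (less n)
  let ?B = "\<Pi>\<^sub>M i\<in>UNIV :: nat set. borel :: 'b measure"
  have ne: "Measurable.pred ?B (\<lambda>y. y k \<noteq> dedup y j)" if "j \<in> {..<n}" for k j
  proof -
    have "(\<lambda>y. dedup y j) \<in> borel_measurable ?B"
      using that less.IH by simp
    moreover have "(\<lambda>y. y k) \<in> borel_measurable ?B"
      by simp
    ultimately have "{y \<in> space ?B. y k = dedup y j} \<in> sets ?B"
      by (intro measurable_equality_set)
    then have "Measurable.pred ?B (\<lambda>y. y k = dedup y j)"
      by (simp only: pred_def)
    then show ?thesis
      by (rule pred_intros_logic)
  qed
  have "Measurable.pred ?B (\<lambda>y. \<forall>j\<in>{..<n}. y k \<noteq> dedup y j)" for k
    by (rule pred_intros_finite(3)[OF finite_lessThan]) (rule ne)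
  then have idx: "(\<lambda>y. LEAST k. \<forall>j\<in>{..<n}. y k \<noteq> dedup y j) \<in> ?B \<rightarrow>\<^sub>M count_space UNIV"
    by (rule measurable_Least)
  have meas: "(\<lambda>y. y (LEAST k. \<forall>j\<in>{..<n}. y k \<noteq> dedup y j)) \<in> borel_measurable ?B"
    by (rule measurable_compose_countable[where f="\<lambda>k y. y k", OF _ idx]) simp
  have eq: "(\<lambda>y. dedup y n) = (\<lambda>y. y (LEAST k. \<forall>j\<in>{..<n}. y k \<noteq> dedup y j))"
    by (rule ext, rule dedup.simps)
  show ?case
    unfolding eq by (rule meas)
qed

subsection \<open>Laws of the counts of Poisson processes\<close>

text \<open>Removing \<open>x\<close> from \<open>B\<close> avoids a distinction on
  \<open>x \<in> S\<close>: the correction term depends only on \<open>x\<close> and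
  \<open>B\<close>, so it is deterministic when \<open>S\<close> is random.\<close>

lemma card_insert_Int:
  assumes "finite (S \<inter> B)"
  shows "card (insert x S \<inter> B) = card (S \<inter> (B - {x})) + of_bool (x \<in> B)"
proof (cases "x \<in> B")
  case True
  then have "insert x S \<inter> B = insert x (S \<inter> (B - {x}))" by auto
  moreover have "finite (S \<inter> (B - {x}))" using assms by (rule rev_finite_subset) auto
  ultimately show ?thesis using True by simp
next
  case False
  then have "insert x S \<inter> B = S \<inter> (B - {x})" by auto
  then show ?thesis using False by simp
qed

section \<open>Point processes and the algebras they generate\<close>

lemma locally_finite_insert: "locally_finite S \<Longrightarrow> locally_finite (insert x S)"
  by (simp add: locally_finite_def Int_insert_left)

lemma point_process_finite:
  "point_process M S \<Longrightarrow> \<omega> \<in> space M \<Longrightarrow> bounded B \<Longrightarrow> finite (S \<omega> \<inter> B)"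
  by (simp add: point_process_def locally_finite_def)

lemma point_process_count:
  "point_process M S \<Longrightarrow> B \<in> sets borel \<Longrightarrow> bounded B \<Longrightarrow>
    (\<lambda>\<omega>. card (S \<omega> \<inter> B)) \<in> M \<rightarrow>\<^sub>M count_space UNIV"
  by (simp add: point_process_def)

lemma point_process_insert:
  assumes "point_process M S"
  shows "point_process M (\<lambda>\<omega>. insert x (S \<omega>))"
  unfolding point_process_def
proof (intro conjI ballI impI)
  show "locally_finite (insert x (S \<omega>))" if "\<omega> \<in> space M" for \<omega>
    using assms that by (simp add: point_process_def locally_finite_insert)
  fix B :: "'b set" assume B: "B \<in> sets borel" "bounded B"
  then have "B - {x} \<in> sets borel" "bounded (B - {x})"
    by (auto intro: bounded_subset)
  then have "(\<lambda>\<omega>. card (S \<omega> \<inter> (B - {x})) + of_bool (x \<in> B)) \<in> M \<rightarrow>\<^sub>M count_space UNIV"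
    using point_process_count[OF assms] by measurable
  moreover have "card (insert x (S \<omega>) \<inter> B) = card (S \<omega> \<inter> (B - {x})) + of_bool (x \<in> B)" if "\<omega> \<in> space M" for \<omega>
    using assms B that by (intro card_insert_Int point_process_finite)
  ultimately show "(\<lambda>\<omega>. card (insert x (S \<omega>) \<inter> B)) \<in> M \<rightarrow>\<^sub>M count_space UNIV"
    by (simp cong: measurable_cong)
qed

lemma process_algebra_generators:
  "{{\<omega>\<in>space M. card (S \<omega> \<inter> B) = n} | B n. B \<in> sets borel \<and> bounded B} \<subseteq> Pow (space M)"
  by auto

lemma space_process_algebra [simp]: "space (process_algebra M S) = space M"
  unfolding process_algebra_def using process_algebra_generators by (rule space_measure_of)

lemma process_algebra_count:
  assumes "B \<in> sets borel" "bounded B"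
  shows "(\<lambda>\<omega>. card (S \<omega> \<inter> B)) \<in> process_algebra M S \<rightarrow>\<^sub>M count_space UNIV"
proof -
  have "{\<omega>\<in>space M. card (S \<omega> \<inter> B) = n} \<in> sets (process_algebra M S)" for n
    unfolding process_algebra_def sets_measure_of[OF process_algebra_generators]
    using assms by (intro sigma_sets.Basic) blast
  then show ?thesis
    by (simp add: measurable_count_space_eq2_countable vimage_def Int_def conj_commute)
qed

lemma subalgebra_process_algebra:
  assumes "point_process M S"
  shows "subalgebra M (process_algebra M S)"
proof -
  have "{\<omega>\<in>space M. card (S \<omega> \<inter> B) = n} \<in> sets M" if "B \<in> sets borel" "bounded B" for B n
    using measurable_sets[OF point_process_count[OF assms that], of "{n}"]
    by (simp add: vimage_def Int_def conj_commute)
  then have "sigma_sets (space M) {{\<omega>\<in>space M. card (S \<omega> \<inter> B) = n} | B n. B \<in> sets borel \<and> bounded B} \<subseteq> sets M"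
    by (intro sets.sigma_sets_subset) auto
  then show ?thesis
    unfolding subalgebra_def space_process_algebra
    unfolding process_algebra_def sets_measure_of[OF process_algebra_generators] by simp
qed

section \<open>Joint laws of Poisson counts\<close>

lemma homogeneous_poisson_processD:
  assumes "homogeneous_poisson_process M l S"
  shows "point_process M S"
    and "B \<in> sets borel \<Longrightarrow> bounded B \<Longrightarrow> \<P>(\<omega> in M. card (S \<omega> \<inter> B) = n)
          = (l * measure lborel B) ^ n / fact n * exp (- (l * measure lborel B))"
    and "finite \<B> \<Longrightarrow> disjoint \<B> \<Longrightarrow> (\<And>B. B \<in> \<B> \<Longrightarrow> B \<in> sets borel \<and> bounded B) \<Longrightarrow>
        prob_space.indep_vars M (\<lambda>_. count_space UNIV) (\<lambda>B \<omega>. card (S \<omega> \<inter> B)) \<B>"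
  using assms unfolding homogeneous_poisson_process_def by blast+

lemma poisson_count_distr_eq:
  assumes M: "prob_space M" "prob_space M'"
    and P: "homogeneous_poisson_process M l P" "homogeneous_poisson_process M' l P'"
    and B: "B \<in> sets borel" "bounded B"
  shows "distr M (count_space UNIV) (\<lambda>\<omega>. card (P \<omega> \<inter> B)) = distr M' (count_space UNIV) (\<lambda>\<omega>. card (P' \<omega> \<inter> B))"
proof (rule measure_eqI_countable[where A=UNIV])
  have "emeasure (distr N (count_space UNIV) (\<lambda>\<omega>. card (S \<omega> \<inter> B))) {n} =
      ennreal ((l * measure lborel B) ^ n / fact n * exp (- (l * measure lborel B)))"
    if "prob_space N" "homogeneous_poisson_process N l S" for N :: "'x measure" and S n
  proof -
    interpret prob_space N by fact
    have "emeasure (distr N (count_space UNIV) (\<lambda>\<omega>. card (S \<omega> \<inter> B))) {n} = emeasure N ({\<omega>\<in>space N. card (S \<omega> \<inter> B) = n})"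
      using point_process_count[OF homogeneous_poisson_processD(1)[OF that(2)] B]
      by (subst emeasure_distr) (auto simp: vimage_def Int_def conj_commute)
    then show ?thesis
      using homogeneous_poisson_processD(2)[OF that(2) B] by (simp add: emeasure_eq_measure)
  qed
  from this[OF M(1) P(1)] this[OF M(2) P(2)]
  show "emeasure (distr M (count_space UNIV) (\<lambda>\<omega>. card (P \<omega> \<inter> B))) {n} =
      emeasure (distr M' (count_space UNIV) (\<lambda>\<omega>. card (P' \<omega> \<inter> B))) {n}" for n
    by simp
qed auto

text \<open>The sets are split into the atoms of the algebra that they generate, whose counts are
  independent.\<close>
lemma poisson_counts_distr_eq:
  fixes P :: "'a \<Rightarrow> 'c::euclidean_space set" and P' :: "'b \<Rightarrow> 'c set" and B :: "'i \<Rightarrow> 'c set"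
  assumes M: "prob_space M" "prob_space M'"
    and P: "homogeneous_poisson_process M l P" "homogeneous_poisson_process M' l P'"
    and I: "finite I" and B: "\<And>i. i \<in> I \<Longrightarrow> B i \<in> sets borel" "\<And>i. i \<in> I \<Longrightarrow> bounded (B i)"
  shows "distr M (\<Pi>\<^sub>M i\<in>I. count_space UNIV) (\<lambda>\<omega>. \<lambda>i\<in>I. card (P \<omega> \<inter> B i)) =
    distr M' (\<Pi>\<^sub>M i\<in>I. count_space UNIV) (\<lambda>\<omega>. \<lambda>i\<in>I. card (P' \<omega> \<inter> B i))"
proof -
  \<comment> \<open>Complements are taken inside the union \<open>D\<close>, which keeps every atom
    bounded, as the independence property demands.\<close>
  define D where "D = (\<Union>i\<in>I. B i)"
  define atom where "atom J = D \<inter> (\<Inter>i\<in>I. if i \<in> J then B i else D - B i)" for J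
  \<comment> \<open>Different \<open>J\<close> may give the same atom only if it is empty. Passing
    to the set of atoms removes these repetitions, so that its members are pairwise
    disjoint.\<close>
  define \<A> where "\<A> = atom ` Pow I"
  have D: "D \<in> sets borel" "bounded D"
    using I B by (auto simp: D_def)
  have atom: "x \<in> atom J \<longleftrightarrow> x \<in> D \<and> {i\<in>I. x \<in> B i} = J" if "J \<subseteq> I" for J x
    using that by (auto simp: atom_def split: if_splits)
  have fin: "finite \<A>" and ne: "\<A> \<noteq> {}"
    using I by (auto simp: \<A>_def)
  have disj: "disjoint \<A>"
    unfolding \<A>_def by (auto simp: disjoint_def atom)
  have A: "C \<in> sets borel \<and> bounded C" if C: "C \<in> \<A>" for C
  proof -
    obtain J where C: "C = atom J" using C by (auto simp: \<A>_def)
    have "(if i \<in> J then B i else D - B i) \<in> sets borel" if "i \<in> I" for i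
      using D B(1)[OF that] by auto
    then have "atom J \<in> sets borel"
      unfolding atom_def using D(1) I by (cases "I = {}") (simp, intro sets.Int sets.finite_INT)
    then show ?thesis
      unfolding C using D by (auto simp: atom_def intro: bounded_subset)
  qed
  define \<A>' where "\<A>' i = {C\<in>\<A>. C \<subseteq> B i}" for i
  have B_eq: "B i = \<Union> (\<A>' i)" if "i \<in> I" for i
  proof
    show "B i \<subseteq> \<Union> (\<A>' i)"
    proof
      fix x assume x: "x \<in> B i"
      define J where "J = {i\<in>I. x \<in> B i}"
      have J: "J \<subseteq> I" "i \<in> J" using x that by (auto simp: J_def)
      have "x \<in> atom J" using x that J by (auto simp: atom J_def D_def)
      moreover have "atom J \<in> \<A>' i"
        using J by (auto simp: \<A>'_def \<A>_def atom)
      ultimately show "x \<in> \<Union> (\<A>' i)" by blast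
    qed
  qed (auto simp: \<A>'_def)
  have card_B: "card (S \<inter> B i) = (\<Sum>C\<in>\<A>' i. card (S \<inter> C))" if S: "locally_finite S" and i: "i \<in> I" for S i
  proof -
    have "S \<inter> B i = (\<Union>C\<in>\<A>' i. S \<inter> C)" using B_eq[OF i] by auto
    moreover have "card (\<Union>C\<in>\<A>' i. S \<inter> C) = (\<Sum>C\<in>\<A>' i. card (S \<inter> C))"
    proof (rule card_UN_disjoint)
      show "finite (\<A>' i)" using fin by (simp add: \<A>'_def)
      show "\<forall>C\<in>\<A>' i. finite (S \<inter> C)"
        using S A by (simp add: \<A>'_def locally_finite_def)
      show "\<forall>C\<in>\<A>' i. \<forall>C'\<in>\<A>' i. C \<noteq> C' \<longrightarrow> S \<inter> C \<inter> (S \<inter> C') = {}"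
        using disj by (auto simp: \<A>'_def disjoint_def)
    qed
    ultimately show ?thesis by simp
  qed
  let ?N = "count_space UNIV :: nat measure"
  let ?f = "\<lambda>n. \<lambda>i\<in>I. \<Sum>C\<in>\<A>' i. n C"
  have f: "?f \<in> (\<Pi>\<^sub>M C\<in>\<A>. ?N) \<rightarrow>\<^sub>M (\<Pi>\<^sub>M i\<in>I. ?N)"
    using fin by (intro measurable_restrict) (simp add: count_space_PiM_finite)
  \<comment> \<open>The counts of the \<open>B i\<close> are a fixed function \<open>?f\<close> of
    the independent counts of the atoms. Their joint law is thus the image of a product of
    one-dimensional laws, and two processes need only be compared atom by atom.\<close>
  have law: "distr N (\<Pi>\<^sub>M i\<in>I. ?N) (\<lambda>\<omega>. \<lambda>i\<in>I. card (S \<omega> \<inter> B i)) =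
      distr (\<Pi>\<^sub>M C\<in>\<A>. distr N ?N (\<lambda>\<omega>. card (S \<omega> \<inter> C))) (\<Pi>\<^sub>M i\<in>I. ?N) ?f"
    if N: "prob_space N" "homogeneous_poisson_process N l S" for N :: "'x measure" and S
  proof -
    interpret prob_space N by fact
    note pp = homogeneous_poisson_processD(1)[OF N(2)]
    have rv: "(\<lambda>\<omega>. card (S \<omega> \<inter> C)) \<in> N \<rightarrow>\<^sub>M ?N" if "C \<in> \<A>" for C
      using A[OF that] by (intro point_process_count[OF pp]) auto
    have "indep_vars (\<lambda>_. ?N) (\<lambda>C \<omega>. card (S \<omega> \<inter> C)) \<A>"
      using fin disj A by (rule homogeneous_poisson_processD(3)[OF N(2)])
    then have "distr N (\<Pi>\<^sub>M C\<in>\<A>. ?N) (\<lambda>\<omega>. \<lambda>C\<in>\<A>. card (S \<omega> \<inter> C)) =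
        (\<Pi>\<^sub>M C\<in>\<A>. distr N ?N (\<lambda>\<omega>. card (S \<omega> \<inter> C)))"
      using rv by (subst (asm) indep_vars_iff_distr_eq_PiM'[OF ne]) auto
    then have "distr (\<Pi>\<^sub>M C\<in>\<A>. distr N ?N (\<lambda>\<omega>. card (S \<omega> \<inter> C))) (\<Pi>\<^sub>M i\<in>I. ?N) ?f =
        distr (distr N (\<Pi>\<^sub>M C\<in>\<A>. ?N) (\<lambda>\<omega>. \<lambda>C\<in>\<A>. card (S \<omega> \<inter> C))) (\<Pi>\<^sub>M i\<in>I. ?N) ?f"
      by simp
    also have "\<dots> = distr N (\<Pi>\<^sub>M i\<in>I. ?N) (?f \<circ> (\<lambda>\<omega>. \<lambda>C\<in>\<A>. card (S \<omega> \<inter> C)))"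
      using rv by (intro distr_distr[OF f] measurable_restrict)
    also have "\<dots> = distr N (\<Pi>\<^sub>M i\<in>I. ?N) (\<lambda>\<omega>. \<lambda>i\<in>I. card (S \<omega> \<inter> B i))"
    proof (intro distr_cong refl)
      fix \<omega> assume "\<omega> \<in> space N"
      then have "locally_finite (S \<omega>)" using pp by (simp add: point_process_def)
      then show "(?f \<circ> (\<lambda>\<omega>. \<lambda>C\<in>\<A>. card (S \<omega> \<inter> C))) \<omega> = (\<lambda>i\<in>I. card (S \<omega> \<inter> B i))"
        by (auto simp: fun_eq_iff card_B \<A>'_def intro!: sum.cong)
    qed
    finally show ?thesis ..
  qed
  have "(\<Pi>\<^sub>M C\<in>\<A>. distr M ?N (\<lambda>\<omega>. card (P \<omega> \<inter> C))) = (\<Pi>\<^sub>M C\<in>\<A>. distr M' ?N (\<lambda>\<omega>. card (P' \<omega> \<inter> C)))"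
    using A by (intro PiM_cong refl poisson_count_distr_eq[OF M P]) auto
  then show ?thesis
    using law[OF M(1) P(1)] law[OF M(2) P(2)] by simp
qed

subsection \<open>Scaling networks\<close>

lemma bounded_vimage_scaleR:
  fixes B :: "'b::real_normed_vector set"
  assumes "c \<noteq> 0" "bounded B"
  shows "bounded ((*\<^sub>R) c -` B)"
proof -
  have "(*\<^sub>R) c -` B \<subseteq> (*\<^sub>R) (inverse c) ` B"
    using assms by (auto intro!: image_eqI)
  with bounded_scaling[OF assms(2)] show ?thesis
    by (rule bounded_subset)
qed

lemma vimage_scaleR_borel:
  fixes B :: "'b::real_normed_vector set"
  shows "B \<in> sets borel \<Longrightarrow> (*\<^sub>R) c -` B \<in> sets borel"
  using measurable_sets[of "(*\<^sub>R) c" borel borel B] by simp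

lemma emeasure_vimage_scaleR:
  fixes B :: "'b::euclidean_space set"
  assumes "c > 0" "B \<in> sets borel"
  shows "emeasure lborel B = ennreal (c ^ DIM('b)) * emeasure lborel ((*\<^sub>R) c -` B)"
proof -
  have "emeasure lborel B = emeasure (density (distr lborel borel (\<lambda>x. 0 + c *\<^sub>R x)) (\<lambda>_. ennreal (\<bar>c\<bar> ^ DIM('b)))) B"
    using assms by (subst lborel_affine[of c 0]) auto
  also have "\<dots> = ennreal (c ^ DIM('b)) * emeasure (distr lborel borel ((*\<^sub>R) c)) B"
    using assms by (subst emeasure_density_const) auto
  also have "emeasure (distr lborel borel ((*\<^sub>R) c)) B = emeasure lborel ((*\<^sub>R) c -` B)"
    using assms by (subst emeasure_distr) auto
  finally show ?thesis .
qed

lemma measure_vimage_scaleR: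
  fixes B :: "'b::euclidean_space set"
  assumes "c > 0" "B \<in> sets borel"
  shows "measure lborel ((*\<^sub>R) c -` B) = measure lborel B / c ^ DIM('b)"
  using assms by (simp add: measure_def emeasure_vimage_scaleR[OF assms] enn2real_mult)

lemma scaleR_image_Int:
  fixes S :: "'b::real_vector set"
  shows "(*\<^sub>R) c ` S \<inter> B = (*\<^sub>R) c ` (S \<inter> (*\<^sub>R) c -` B)"
  by auto

lemma card_scaleR_image_Int:
  fixes S :: "'b::real_vector set"
  assumes "c \<noteq> 0"
  shows "card ((*\<^sub>R) c ` S \<inter> B) = card (S \<inter> (*\<^sub>R) c -` B)"
  unfolding scaleR_image_Int
  using assms by (intro card_image) (auto simp: inj_on_def)

text \<open>The counts of a scaled process are the counts of the original one in preimages; this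
  carries independence over from the preimages to the sets themselves.\<close>

lemma (in prob_space) indep_vars_reindex:
  assumes inj: "inj_on h I" and indep: "indep_vars N X (h ` I)"
  shows "indep_vars (N \<circ> h) (X \<circ> h) I"
  unfolding indep_vars_def2 indep_sets_def
proof (intro conjI ballI allI impI)
  note ind = indep[unfolded indep_vars_def2 indep_sets_def]
  show "random_variable ((N \<circ> h) i) ((X \<circ> h) i)" if "i \<in> I" for i
    using ind that by auto
  show "{(X \<circ> h) i -` A \<inter> space M |A. A \<in> sets ((N \<circ> h) i)} \<subseteq> events" if "i \<in> I" for i
    using ind that by auto
  fix J A assume J: "J \<subseteq> I" "J \<noteq> {}" "finite J"
    and A: "A \<in> (\<Pi> i\<in>J. {(X \<circ> h) i -` A \<inter> space M |A. A \<in> sets ((N \<circ> h) i)})"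
  have injJ: "inj_on h J" using inj J(1) by (rule inj_on_subset)
  define A' where "A' = A \<circ> the_inv_into J h"
  have A': "A' (h j) = A j" if "j \<in> J" for j
    using that injJ by (simp add: A'_def the_inv_into_f_f)
  have "A' \<in> (\<Pi> i\<in>h ` J. {X i -` A \<inter> space M |A. A \<in> sets (N i)})"
    using A A' by (fastforce simp: Pi_iff)
  then have "prob (\<Inter>j\<in>h ` J. A' j) = (\<Prod>j\<in>h ` J. prob (A' j))"
    using ind[THEN conjunct2, THEN conjunct2, rule_format, of "h ` J" A'] J by blast
  then show "prob (\<Inter>j\<in>J. A j) = (\<Prod>j\<in>J. prob (A j))"
    using A' by (simp add: prod.reindex[OF injJ])
qed

text \<open>A set \<open>B\<close> contains as many scaled points as its preimage contains original
  ones. The preimage has the measure of \<open>B\<close> divided by \<open>c ^ DIM('b)\<close>, and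
  preimages of disjoint sets are disjoint.\<close>

lemma homogeneous_poisson_process_scale:
  fixes P :: "'a \<Rightarrow> 'b::euclidean_space set"
  assumes M: "prob_space M" and P: "homogeneous_poisson_process M l P" and c: "c > 0"
  shows "homogeneous_poisson_process M (l / c ^ DIM('b)) (\<lambda>\<omega>. (*\<^sub>R) c ` P \<omega>)"
proof -
  interpret prob_space M by fact
  have c0: "c \<noteq> 0" using c by simp
  note pp = homogeneous_poisson_processD(1)[OF P]
  have V: "(*\<^sub>R) c -` B \<in> sets borel \<and> bounded ((*\<^sub>R) c -` B)" if "B \<in> sets borel \<and> bounded B" for B :: "'b set"
    using that vimage_scaleR_borel bounded_vimage_scaleR[OF c0] by blast
  show ?thesis
    unfolding homogeneous_poisson_process_def point_process_def card_scaleR_image_Int[OF c0]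
  proof (intro conjI ballI allI impI)
    show "locally_finite ((*\<^sub>R) c ` P \<omega>)" if "\<omega> \<in> space M" for \<omega>
      unfolding locally_finite_def scaleR_image_Int
      using point_process_finite[OF pp that] bounded_vimage_scaleR[OF c0] by blast
    fix B :: "'b set" assume B: "B \<in> sets borel" "bounded B"
    show "(\<lambda>\<omega>. card (P \<omega> \<inter> (*\<^sub>R) c -` B)) \<in> M \<rightarrow>\<^sub>M count_space UNIV"
      using V B by (intro point_process_count[OF pp]) auto
    show "\<P>(\<omega> in M. card (P \<omega> \<inter> (*\<^sub>R) c -` B) = n) =
        (l / c ^ DIM('b) * measure lborel B) ^ n / fact n * exp (- (l / c ^ DIM('b) * measure lborel B))" for n
      using V B homogeneous_poisson_processD(2)[OF P, of "(*\<^sub>R) c -` B" n]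
      by (simp add: measure_vimage_scaleR[OF c B(1)])
  next
    fix \<B> :: "'b set set" assume \<B>: "finite \<B>" "disjoint \<B>" "\<forall>B\<in>\<B>. B \<in> sets borel \<and> bounded B"
    let ?V = "(-`) ((*\<^sub>R) c) :: 'b set \<Rightarrow> 'b set"
    have "surj ((*\<^sub>R) c :: 'b \<Rightarrow> 'b)"
      using c0 by (intro surjI[of _ "(*\<^sub>R) (inverse c)"]) simp
    \<comment> \<open>Surjectivity of the scaling lets a set be recovered from its preimage, so
      distinct sets remain distinct as indices.\<close>
    then have inj: "inj_on ?V \<B>"
      by (intro inj_onI) (metis surj_image_vimage_eq)
    have "indep_vars (\<lambda>_. count_space UNIV) (\<lambda>B \<omega>. card (P \<omega> \<inter> B)) (?V ` \<B>)"
    proof (rule homogeneous_poisson_processD(3)[OF P])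
      show "disjoint (?V ` \<B>)"
        using \<B>(2) by (fastforce simp: disjoint_def)
    qed (use \<B> V in auto)
    from indep_vars_reindex[OF inj this]
    show "indep_vars (\<lambda>_. count_space UNIV) (\<lambda>B \<omega>. card (P \<omega> \<inter> (*\<^sub>R) c -` B)) \<B>"
      by (simp add: o_def)
  qed
qed

text \<open>Taking preimages permutes the bounded Borel sets, so both algebras have the same
  generators.\<close>

lemma process_algebra_scale:
  fixes S :: "'a \<Rightarrow> 'b::euclidean_space set"
  assumes c: "c \<noteq> 0"
  shows "process_algebra M (\<lambda>\<omega>. (*\<^sub>R) c ` S \<omega>) = process_algebra M S"
proof -
  have "{{\<omega>\<in>space M. card (S \<omega> \<inter> (*\<^sub>R) c -` B) = n} | B n. B \<in> sets borel \<and> bounded B} =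
      {{\<omega>\<in>space M. card (S \<omega> \<inter> B) = n} | B n. B \<in> sets borel \<and> bounded B}" (is "?L = ?R")
  proof
    show "?L \<subseteq> ?R"
      using vimage_scaleR_borel bounded_vimage_scaleR[OF c] by blast
    show "?R \<subseteq> ?L"
    proof safe
      fix B :: "'b set" and n assume B: "B \<in> sets borel" "bounded B"
      have "B = (*\<^sub>R) c -` (*\<^sub>R) (inverse c) -` B"
        using c by auto
      then have "{\<omega>\<in>space M. card (S \<omega> \<inter> B) = n} =
          {\<omega>\<in>space M. card (S \<omega> \<inter> (*\<^sub>R) c -` (*\<^sub>R) (inverse c) -` B) = n}"
        by simp
      moreover have "(*\<^sub>R) (inverse c) -` B \<in> sets borel" "bounded ((*\<^sub>R) (inverse c) -` B)"
        using B c vimage_scaleR_borel bounded_vimage_scaleR[of "inverse c" B] by auto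
      ultimately show "\<exists>B' n'. {\<omega>\<in>space M. card (S \<omega> \<inter> B) = n} = {\<omega>\<in>space M. card (S \<omega> \<inter> (*\<^sub>R) c -` B') = n'} \<and>
          B' \<in> sets borel \<and> bounded B'"
        by blast
    qed
  qed
  then show ?thesis
    by (simp add: process_algebra_def card_scaleR_image_Int[OF c])
qed

lemma selection_scale:
  fixes S :: "'a \<Rightarrow> 'b::euclidean_space set"
  assumes c: "c \<noteq> 0"
  shows "selection M (\<lambda>\<omega>. (*\<^sub>R) c ` S \<omega>) Y \<longleftrightarrow> selection M S (\<lambda>\<omega>. Y \<omega> /\<^sub>R c)"
proof -
  have "Y \<in> borel_measurable N \<longleftrightarrow> (\<lambda>\<omega>. Y \<omega> /\<^sub>R c) \<in> borel_measurable N" for N :: "'a measure"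
  proof
    show "(\<lambda>\<omega>. Y \<omega> /\<^sub>R c) \<in> borel_measurable N" if "Y \<in> borel_measurable N"
      using that by measurable
    assume "(\<lambda>\<omega>. Y \<omega> /\<^sub>R c) \<in> borel_measurable N"
    then have "(\<lambda>\<omega>. c *\<^sub>R (Y \<omega> /\<^sub>R c)) \<in> borel_measurable N"
      by (rule borel_measurable_scaleR[OF borel_measurable_const])
    moreover have "(\<lambda>\<omega>. c *\<^sub>R (Y \<omega> /\<^sub>R c)) = Y"
      using c by auto
    ultimately show "Y \<in> borel_measurable N" by simp
  qed
  moreover have "y \<in> (*\<^sub>R) c ` T \<longleftrightarrow> y /\<^sub>R c \<in> T" for y :: 'b and T
    using c by (force intro: image_eqI[of _ _ "y /\<^sub>R c"])
  ultimately show ?thesis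
    by (simp add: selection_def process_algebra_scale[OF c])
qed

section \<open>Voronoi cells and networks under scaling\<close>

lemma closed_voronoi_cell: "closed (voronoi_cell S y :: 'b::metric_space set)"
proof -
  have "voronoi_cell S y = (\<Inter>z\<in>S. {u. dist u y \<le> dist u z})"
    by (auto simp: voronoi_cell_def)
  also have "closed \<dots>"
    by (intro closed_INT ballI closed_Collect_le continuous_intros)
  finally show ?thesis .
qed

lemma voronoi_cell_scale:
  fixes S :: "'b::real_normed_vector set"
  assumes c: "c > 0"
  shows "(*\<^sub>R) c -` voronoi_cell ((*\<^sub>R) c ` S) y = voronoi_cell S (y /\<^sub>R c)"
proof -
  have "dist (c *\<^sub>R u) z = c * dist u (z /\<^sub>R c)" for u z :: 'b
  proof -
    have "c *\<^sub>R u - z = c *\<^sub>R (u - z /\<^sub>R c)"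
      using c by (simp add: scaleR_diff_right)
    then show ?thesis
      using c by (simp add: dist_norm)
  qed
  then show ?thesis
    using c by (auto simp: voronoi_cell_def)
qed

text \<open>The volume factor \<open>c ^ DIM('b)\<close> occurs in the numerator and in the
  denominator of the uniform probability and cancels.\<close>

lemma measure_uniform_voronoi_scale:
  fixes S :: "'b::euclidean_space set"
  assumes c: "c > 0" and A: "A \<in> sets borel"
  shows "measure (uniform_measure lborel (voronoi_cell S (y /\<^sub>R c))) ((*\<^sub>R) c -` A) =
    measure (uniform_measure lborel (voronoi_cell ((*\<^sub>R) c ` S) y)) A"
proof -
  let ?V = "voronoi_cell ((*\<^sub>R) c ` S) y" and ?W = "voronoi_cell S (y /\<^sub>R c)"
  have V: "?V \<in> sets borel" "?W \<in> sets borel"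
    by (auto intro: borel_closed closed_voronoi_cell)
  have d: "ennreal (c ^ DIM('b)) \<noteq> 0" "ennreal (c ^ DIM('b)) \<noteq> \<infinity>"
    using c by auto
  have "emeasure (uniform_measure lborel ?V) A = emeasure lborel (?V \<inter> A) / emeasure lborel ?V"
    using V A by simp
  also have "\<dots> = emeasure lborel ((*\<^sub>R) c -` (?V \<inter> A)) / emeasure lborel ((*\<^sub>R) c -` ?V)"
    using V A divide_mult_eq[OF d]
    by (simp add: emeasure_vimage_scaleR[OF c, of "?V \<inter> A"] emeasure_vimage_scaleR[OF c, of ?V] mult.commute[of "ennreal _"])
  also have "\<dots> = emeasure (uniform_measure lborel ?W) ((*\<^sub>R) c -` A)"
    using V A by (simp add: voronoi_cell_scale[OF c] vimage_Int vimage_scaleR_borel)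
  finally show ?thesis
    by (simp add: measure_def)
qed

lemma (in cellular_network) scale:
  assumes c: "c > 0"
  shows "cellular_network M (l / c\<^sup>2) (\<lambda>\<omega>. (*\<^sub>R) c ` P \<omega>) (\<lambda>\<omega> y. c *\<^sub>R U \<omega> (y /\<^sub>R c))"
proof
  have c0: "c \<noteq> 0" using c by simp
  show "0 < l / c\<^sup>2" using c density_pos by simp
  show "homogeneous_poisson_process M (l / c\<^sup>2) (\<lambda>\<omega>. (*\<^sub>R) c ` P \<omega>)"
    using homogeneous_poisson_process_scale[OF prob_space_axioms poisson c] by (simp add: power2_eq_square)
  let ?S = "\<lambda>\<omega>. insert 0 (P \<omega>)"
  have S: "(\<lambda>\<omega>. insert 0 ((*\<^sub>R) c ` P \<omega>)) = (\<lambda>\<omega>. (*\<^sub>R) c ` ?S \<omega>)"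
    by simp
  show "independent_uniform_mobiles M (\<lambda>\<omega>. insert 0 ((*\<^sub>R) c ` P \<omega>)) (\<lambda>\<omega> y. c *\<^sub>R U \<omega> (y /\<^sub>R c))"
    unfolding S independent_uniform_mobiles_def selection_scale[OF c0] process_algebra_scale[OF c0]
  proof (intro conjI allI impI)
    show "(\<lambda>\<omega>. c *\<^sub>R U \<omega> (Y \<omega> /\<^sub>R c)) \<in> borel_measurable M" if "selection M ?S (\<lambda>\<omega>. Y \<omega> /\<^sub>R c)" for Y
      using mobiles that unfolding independent_uniform_mobiles_def by (intro borel_measurable_scaleR) auto
    fix n :: nat and Y :: "nat \<Rightarrow> 'a \<Rightarrow> real^2" and A :: "nat \<Rightarrow> (real^2) set"
    assume YA: "\<forall>i<n. selection M ?S (\<lambda>\<omega>. Y i \<omega> /\<^sub>R c) \<and> A i \<in> sets borel"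
    \<comment> \<open>The assumption on the original mobiles is used for the rescaled selections and
      the preimages of the test sets.\<close>
    define Y' where "Y' = (\<lambda>i \<omega>. Y i \<omega> /\<^sub>R c)"
    define A' where "A' i = (*\<^sub>R) c -` A i" for i
    have "\<forall>i<n. selection M ?S (Y' i) \<and> A' i \<in> sets borel"
      using YA by (simp add: Y'_def A'_def vimage_scaleR_borel)
    then have "AE \<omega> in M. inj_on (\<lambda>i. Y' i \<omega>) {..<n} \<longrightarrow>
        real_cond_exp M (process_algebra M ?S) (indicator {\<omega>'\<in>space M. \<forall>i<n. U \<omega>' (Y' i \<omega>') \<in> A' i}) \<omega> =
        (\<Prod>i<n. measure (uniform_measure lborel (voronoi_cell (?S \<omega>) (Y' i \<omega>))) (A' i))"
      using mobiles unfolding independent_uniform_mobiles_def by blast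
    moreover have "inj_on (\<lambda>i. Y' i \<omega>) {..<n} \<longleftrightarrow> inj_on (\<lambda>i. Y i \<omega>) {..<n}" for \<omega>
      using c by (simp add: inj_on_def Y'_def)
    moreover have "(\<Prod>i<n. measure (uniform_measure lborel (voronoi_cell (?S \<omega>) (Y' i \<omega>))) (A' i)) =
        (\<Prod>i<n. measure (uniform_measure lborel (voronoi_cell ((*\<^sub>R) c ` ?S \<omega>) (Y i \<omega>))) (A i))" for \<omega>
      unfolding Y'_def A'_def using YA by (intro prod.cong refl measure_uniform_voronoi_scale[OF c]) auto
    ultimately show "AE \<omega> in M. inj_on (\<lambda>i. Y i \<omega>) {..<n} \<longrightarrow>
        real_cond_exp M (process_algebra M ?S) (indicator {\<omega>'\<in>space M. \<forall>i<n. c *\<^sub>R U \<omega>' (Y i \<omega>' /\<^sub>R c) \<in> A i}) \<omega> =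
        (\<Prod>i<n. measure (uniform_measure lborel (voronoi_cell ((*\<^sub>R) c ` ?S \<omega>) (Y i \<omega>))) (A i))"
      by (simp add: Y'_def A'_def)
  qed
qed

lemma (in cellular_network) outage_probability_scale:
  assumes "c > 0" "p > 0"
  shows "outage_probability M (\<lambda>\<omega>. (*\<^sub>R) c ` P \<omega>) (\<lambda>\<omega> y. c *\<^sub>R U \<omega> (y /\<^sub>R c)) \<alpha> \<theta> K p =
    outage_probability M P U \<alpha> \<theta> K p"
proof -
  have "insert 0 ((*\<^sub>R) c ` P \<omega>) = (*\<^sub>R) c ` insert 0 (P \<omega>)" for \<omega>
    by simp
  then show ?thesis
    unfolding outage_probability_eq by (simp only: outage_scale[OF assms])
qed

subsection \<open>Enumerating the points of a process\<close>

text \<open>A set \<open>q k\<close> that meets \<open>S\<close> in one point serves as an address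
  of this point, readable from counts. The choice \<open>q 0 = {}\<close> forces the default value
  at index 0, so the base station at the origin comes first in every enumeration.\<close>

locale separating_sequence =
  fixes q :: "nat \<Rightarrow> 'b::euclidean_space set"
  assumes q_0: "q 0 = {}"
    and q_borel: "q k \<in> sets borel"
    and q_bounded: "bounded (q k)"
    and q_separates: "locally_finite S \<Longrightarrow> x \<in> S \<Longrightarrow> \<exists>k. S \<inter> q k = {x}"

text \<open>The bounded members of a countable basis suffice: only finitely many points of
  \<open>S\<close> lie near \<open>x\<close>, and removing the others from a ball leaves an open
  neighbourhood of \<open>x\<close>.\<close>

lemma separating_sequence_exists: "\<exists>q :: nat \<Rightarrow> 'b::euclidean_space set. separating_sequence q"
proof -
  obtain \<B> :: "'b set set" where \<B>: "countable \<B>" "topological_basis \<B>"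
    using ex_countable_basis by blast
  \<comment> \<open>The empty set makes the family nonempty, so that \<open>from_nat_into\<close>
    stays inside it.\<close>
  define \<C> where "\<C> = insert {} {B\<in>\<B>. bounded B}"
  have \<C>: "countable \<C>" "\<C> \<noteq> {}"
    using \<B>(1) by (auto simp: \<C>_def)
  \<comment> \<open>The shift by one reserves index 0 for the empty set.\<close>
  define q where "q k = (case k of 0 \<Rightarrow> {} | Suc n \<Rightarrow> from_nat_into \<C> n)" for k
  have q: "q k \<in> \<C>" for k
    using from_nat_into[OF \<C>(2)] by (auto simp: q_def \<C>_def split: nat.split)
  have "separating_sequence q"
  proof
    show "q 0 = {}" by (simp add: q_def)
    show "q k \<in> sets borel" for k
      using q[of k] topological_basis_open[OF \<B>(2)] by (auto simp: \<C>_def)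
    show "bounded (q k)" for k
      using q[of k] by (auto simp: \<C>_def)
    fix S :: "'b set" and x assume S: "locally_finite S" "x \<in> S"
    let ?F = "S \<inter> ball x 1 - {x}"
    have "finite ?F"
      using S(1) by (simp add: locally_finite_def)
    then have "open (ball x 1 - ?F)"
      by (intro open_Diff finite_imp_closed) auto
    moreover have "x \<in> ball x 1 - ?F" by simp
    ultimately obtain B where B: "B \<in> \<B>" "x \<in> B" "B \<subseteq> ball x 1 - ?F"
      using topological_basisE[OF \<B>(2)] by metis
    have "bounded B"
      using B(3) by (meson Diff_subset bounded_ball bounded_subset)
    then have "B \<in> \<C>" using B by (simp add: \<C>_def)
    then obtain n where "from_nat_into \<C> n = B"
      using from_nat_into_surj[OF \<C>(1)] by blast
    then have "q (Suc n) = B" by (simp add: q_def)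
    moreover have "S \<inter> B = {x}" using B S(2) by auto
    ultimately show "\<exists>k. S \<inter> q k = {x}" by metis
  qed
  then show ?thesis by blast
qed

text \<open>The default value 0 is the position of the typical base station, so it adds no false
  point to a set that contains the origin.\<close>

definition points :: "(nat \<Rightarrow> 'b::zero set) \<Rightarrow> 'b set \<Rightarrow> nat \<Rightarrow> 'b" where
  "points q S k = (if card (S \<inter> q k) = 1 then the_elem (S \<inter> q k) else 0)"

text \<open>Reduces statements about positions to statements about counts; both the measurability
  and the law of the enumeration rest on it.\<close>

lemma points_mem_iff:
  assumes "finite (S \<inter> q k)"
  shows "points q S k \<in> A \<longleftrightarrow> (if card (S \<inter> q k) = 1 then card (S \<inter> (q k \<inter> A)) = 1 else 0 \<in> A)"
proof (cases "card (S \<inter> q k) = 1")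
  case True
  then obtain x where x: "S \<inter> q k = {x}" by (auto simp: card_1_singleton_iff)
  have "S \<inter> (q k \<inter> A) = (S \<inter> q k) \<inter> A" by blast
  then have "S \<inter> (q k \<inter> A) = (if x \<in> A then {x} else {})" by (simp add: x)
  then show ?thesis by (simp add: points_def x)
qed (simp add: points_def)

context separating_sequence
begin

lemma points_0: "points q S 0 = 0"
  by (simp add: points_def q_0)

lemma range_points:
  assumes "locally_finite S" "0 \<in> S"
  shows "range (points q S) = S"
proof
  have "points q S k \<in> S" for k
  proof -
    \<comment> \<open>For \<open>A = S\<close> the two counts in \<open>points_mem_iff\<close>
      agree, and the default case is covered by \<open>0 \<in> S\<close>.\<close>
    have "S \<inter> (q k \<inter> S) = S \<inter> q k" by blast
    moreover have "finite (S \<inter> q k)"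
      using assms(1) q_bounded by (simp add: locally_finite_def)
    ultimately show ?thesis
      using assms(2) by (simp add: points_mem_iff)
  qed
  then show "range (points q S) \<subseteq> S" by blast
  show "S \<subseteq> range (points q S)"
  proof
    fix x assume "x \<in> S"
    then obtain k where "S \<inter> q k = {x}"
      using q_separates assms(1) by blast
    then have "points q S k = x" by (simp add: points_def)
    then show "x \<in> range (points q S)" by blast
  qed
qed

text \<open>Measurability holds with respect to the algebra of the process itself, as
  \<open>selection\<close> requires, and not merely with respect to \<open>M\<close>.\<close>

lemma measurable_points:
  assumes S: "point_process M S"
  shows "(\<lambda>\<omega>. points q (S \<omega>)) \<in> process_algebra M S \<rightarrow>\<^sub>M (\<Pi>\<^sub>M k\<in>UNIV. borel)"
proof (rule measurable_PiM_single')
  fix k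
  show "(\<lambda>\<omega>. points q (S \<omega>) k) \<in> borel_measurable (process_algebra M S)"
  proof (rule measurableI)
    fix A :: "'b set" assume A: "A \<in> sets borel"
    have [measurable]: "(\<lambda>\<omega>. card (S \<omega> \<inter> q k)) \<in> process_algebra M S \<rightarrow>\<^sub>M count_space UNIV"
      using q_borel q_bounded by (rule process_algebra_count)
    have [measurable]: "(\<lambda>\<omega>. card (S \<omega> \<inter> (q k \<inter> A))) \<in> process_algebra M S \<rightarrow>\<^sub>M count_space UNIV"
      using A q_borel q_bounded by (intro process_algebra_count bounded_Int sets.Int) auto
    have "(\<lambda>\<omega>. points q (S \<omega>) k) -` A \<inter> space (process_algebra M S) =
        {\<omega> \<in> space (process_algebra M S). if card (S \<omega> \<inter> q k) = 1 then card (S \<omega> \<inter> (q k \<inter> A)) = 1 else 0 \<in> A}"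
      using point_process_finite[OF S _ q_bounded] by (auto simp: points_mem_iff)
    also have "\<dots> \<in> sets (process_algebra M S)"
      by measurable
    finally show "(\<lambda>\<omega>. points q (S \<omega>) k) -` A \<inter> space (process_algebra M S) \<in> sets (process_algebra M S)" .
  qed simp
qed auto

end

section \<open>The law of the enumeration, and infinitely many stations\<close>

lemma distr_PiM_UNIV_eqI:
  assumes M: "prob_space M" and X: "X \<in> M \<rightarrow>\<^sub>M (\<Pi>\<^sub>M i\<in>UNIV. N)" "X' \<in> M' \<rightarrow>\<^sub>M (\<Pi>\<^sub>M i\<in>UNIV. N)"
    and eq: "\<And>J A. finite J \<Longrightarrow> (\<And>i. i \<in> J \<Longrightarrow> A i \<in> sets N) \<Longrightarrow>
      emeasure M {\<omega>\<in>space M. \<forall>i\<in>J. X \<omega> i \<in> A i} = emeasure M' {\<omega>\<in>space M'. \<forall>i\<in>J. X' \<omega> i \<in> A i}"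
  shows "distr M (\<Pi>\<^sub>M i\<in>UNIV. N) X = distr M' (\<Pi>\<^sub>M i\<in>UNIV. N) X'"
proof (rule measure_eqI_PiM_infinite[where M="\<lambda>_. N" and I=UNIV])
  fix J :: "'b set" and A assume J: "finite J" and A: "\<And>i. i \<in> J \<Longrightarrow> A i \<in> sets N"
  have cyl: "prod_emb UNIV (\<lambda>_. N) J (Pi\<^sub>E J A) \<in> sets (\<Pi>\<^sub>M i\<in>UNIV. N)"
    using J A by (intro sets_PiM_I) auto
  have "emeasure (distr L (\<Pi>\<^sub>M i\<in>UNIV. N) Z) (prod_emb UNIV (\<lambda>_. N) J (Pi\<^sub>E J A)) =
      emeasure L {\<omega>\<in>space L. \<forall>i\<in>J. Z \<omega> i \<in> A i}" if Z: "Z \<in> L \<rightarrow>\<^sub>M (\<Pi>\<^sub>M i\<in>UNIV. N)" for L :: "'y measure" and Z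
  proof -
    have "Z -` prod_emb UNIV (\<lambda>_. N) J (Pi\<^sub>E J A) \<inter> space L = {\<omega>\<in>space L. \<forall>i\<in>J. Z \<omega> i \<in> A i}"
      using measurable_space[OF Z] by (auto simp: prod_emb_def PiE_iff space_PiM)
    then show ?thesis by (simp add: emeasure_distr[OF Z cyl])
  qed
  from this[OF X(1)] this[OF X(2)] eq[OF J A]
  show "emeasure (distr M (\<Pi>\<^sub>M i\<in>UNIV. N) X) (prod_emb UNIV (\<lambda>_. N) J (Pi\<^sub>E J A)) =
      emeasure (distr M' (\<Pi>\<^sub>M i\<in>UNIV. N) X') (prod_emb UNIV (\<lambda>_. N) J (Pi\<^sub>E J A))"
    by simp
next
  show "finite_measure (distr M (\<Pi>\<^sub>M i\<in>UNIV. N) X)"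
    using prob_space.prob_space_distr[OF M X(1)] by (simp add: prob_space_def)
qed simp_all

lemma (in separating_sequence) distr_points_eq:
  assumes M: "prob_space M" "prob_space M'"
    and P: "homogeneous_poisson_process M l P" "homogeneous_poisson_process M' l P'"
  shows "distr M (\<Pi>\<^sub>M k\<in>UNIV. borel) (\<lambda>\<omega>. points q (insert 0 (P \<omega>))) =
    distr M' (\<Pi>\<^sub>M k\<in>UNIV. borel) (\<lambda>\<omega>. points q (insert 0 (P' \<omega>)))"
proof (rule distr_PiM_UNIV_eqI[OF M(1)])
  have meas: "(\<lambda>\<omega>. points q (insert 0 (S \<omega>))) \<in> N \<rightarrow>\<^sub>M (\<Pi>\<^sub>M k\<in>UNIV. borel)"
    if "homogeneous_poisson_process N l S" for N :: "'x measure" and S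
  proof -
    note pp = point_process_insert[OF homogeneous_poisson_processD(1)[OF that], of 0]
    show ?thesis
      by (rule measurable_from_subalg[OF subalgebra_process_algebra[OF pp] measurable_points[OF pp]])
  qed
  show "(\<lambda>\<omega>. points q (insert 0 (P \<omega>))) \<in> M \<rightarrow>\<^sub>M (\<Pi>\<^sub>M k\<in>UNIV. borel)"
    "(\<lambda>\<omega>. points q (insert 0 (P' \<omega>))) \<in> M' \<rightarrow>\<^sub>M (\<Pi>\<^sub>M k\<in>UNIV. borel)"
    by (rule meas[OF P(1)], rule meas[OF P(2)])
  fix J :: "nat set" and A :: "nat \<Rightarrow> 'b set"
  assume J: "finite J" and A: "\<And>k. k \<in> J \<Longrightarrow> A k \<in> sets borel"
  \<comment> \<open>Each index \<open>k\<close> needs the counts of \<open>q k\<close> and of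
    \<open>q k \<inter> A k\<close>, told apart by a Boolean. The origin is cut out because its
    station is not part of the Poisson process.\<close>
  define B where "B = (\<lambda>(k, b). (if b then q k \<inter> A k else q k) - {0})"
  define I where "I = J \<times> (UNIV :: bool set)"
  have I: "finite I" using J by (simp add: I_def)
  have B: "B i \<in> sets borel" "bounded (B i)" if iI: "i \<in> I" for i
  proof -
    obtain k b where i: "i = (k, b)" "k \<in> J" using iI by (auto simp: I_def)
    show "B i \<in> sets borel"
      using A[OF i(2)] q_borel[of k] by (simp add: i(1) B_def)
    show "bounded (B i)"
      by (rule bounded_subset[OF q_bounded[of k]]) (auto simp: i(1) B_def)
  qed
  \<comment> \<open>\<open>E\<close> is the condition of \<open>points_mem_iff\<close> written for
    count vectors; the \<open>of_bool\<close> terms add the station at the origin back.\<close>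
  define E where "E = {n \<in> (\<Pi>\<^sub>E i\<in>I. UNIV). \<forall>k\<in>J.
      if n (k, False) + of_bool (0 \<in> q k) = (1::nat) then n (k, True) + of_bool (0 \<in> q k \<inter> A k) = (1::nat) else 0 \<in> A k}"
  have E: "E \<in> sets (\<Pi>\<^sub>M i\<in>I. count_space UNIV)"
    using I by (simp add: count_space_PiM_finite E_def)
  have law: "emeasure N {\<omega>\<in>space N. \<forall>k\<in>J. points q (insert 0 (S \<omega>)) k \<in> A k} =
      emeasure (distr N (\<Pi>\<^sub>M i\<in>I. count_space UNIV) (\<lambda>\<omega>. \<lambda>i\<in>I. card (S \<omega> \<inter> B i))) E"
    if S: "homogeneous_poisson_process N l S" for N :: "'x measure" and S
  proof -
    note pp = homogeneous_poisson_processD(1)[OF S]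
    have X: "(\<lambda>\<omega>. \<lambda>i\<in>I. card (S \<omega> \<inter> B i)) \<in> N \<rightarrow>\<^sub>M (\<Pi>\<^sub>M i\<in>I. count_space UNIV)"
      using B by (intro measurable_restrict point_process_count[OF pp])
    have mem: "points q (insert 0 (S \<omega>)) k \<in> A k \<longleftrightarrow>
        (if card (S \<omega> \<inter> B (k, False)) + of_bool (0 \<in> q k) = (1::nat)
         then card (S \<omega> \<inter> B (k, True)) + of_bool (0 \<in> q k \<inter> A k) = (1::nat) else 0 \<in> A k)"
      if \<omega>: "\<omega> \<in> space N" for \<omega> k
    proof -
      have fin: "finite (S \<omega> \<inter> q k)" "finite (S \<omega> \<inter> (q k \<inter> A k))" "finite (insert 0 (S \<omega>) \<inter> q k)"
        using q_bounded[of k]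
        by (intro point_process_finite[OF pp \<omega>] point_process_finite[OF point_process_insert[OF pp] \<omega>]
            bounded_Int disjI1; assumption)+
      show ?thesis
        unfolding points_mem_iff[of _ q k, OF fin(3)] card_insert_Int[OF fin(1)] card_insert_Int[OF fin(2)]
        by (simp add: B_def)
    qed
    have "(\<lambda>i\<in>I. card (S \<omega> \<inter> B i)) \<in> E \<longleftrightarrow> (\<forall>k\<in>J. points q (insert 0 (S \<omega>)) k \<in> A k)"
      if \<omega>: "\<omega> \<in> space N" for \<omega>
      unfolding mem[OF \<omega>] by (simp add: E_def I_def)
    then have "(\<lambda>\<omega>. \<lambda>i\<in>I. card (S \<omega> \<inter> B i)) -` E \<inter> space N =
        {\<omega>\<in>space N. \<forall>k\<in>J. points q (insert 0 (S \<omega>)) k \<in> A k}"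
      by auto
    then show ?thesis
      by (simp add: emeasure_distr[OF X E])
  qed
  have "distr M (\<Pi>\<^sub>M i\<in>I. count_space UNIV) (\<lambda>\<omega>. \<lambda>i\<in>I. card (P \<omega> \<inter> B i)) =
      distr M' (\<Pi>\<^sub>M i\<in>I. count_space UNIV) (\<lambda>\<omega>. \<lambda>i\<in>I. card (P' \<omega> \<inter> B i))"
    using B by (rule poisson_counts_distr_eq[OF M P I])
  then show "emeasure M {\<omega>\<in>space M. \<forall>k\<in>J. points q (insert 0 (P \<omega>)) k \<in> A k} =
      emeasure M' {\<omega>\<in>space M'. \<forall>k\<in>J. points q (insert 0 (P' \<omega>)) k \<in> A k}"
    unfolding law[OF P(1)] law[OF P(2)] by (rule arg_cong)
qed

text \<open>The counts in growing balls have means tending to infinity, so each fixed number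
  \<open>N\<close> has vanishing probability. For a finite set of points these counts would
  eventually be constant.\<close>

lemma AE_infinite_poisson:
  fixes P :: "'a \<Rightarrow> 'b::euclidean_space set"
  assumes M: "prob_space M" and P: "homogeneous_poisson_process M l P" and l: "l > 0"
  shows "AE \<omega> in M. infinite (P \<omega>)"
proof -
  interpret prob_space M by fact
  note pp = homogeneous_poisson_processD(1)[OF P]
  define m where "m r = l * measure lborel (ball (0::'b) (real r))" for r
  have m_eq: "m r = (l * measure lborel (ball (0::'b) 1)) * real r ^ DIM('b)" for r
    using content_ball_conv_unit_ball[of "real r" "0::'b"] by (simp add: m_def)
  have "l * measure lborel (ball (0::'b) 1) > 0"
    using l content_ball_pos[of 1 "0::'b"] by simp
  then have m: "filterlim m at_top sequentially"
    unfolding m_eq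
    by (intro filterlim_tendsto_pos_mult_at_top[OF tendsto_const] filterlim_pow_at_top filterlim_real_sequentially) auto
  \<comment> \<open>The exponential of the mean outgrows its \<open>N\<close>-th power.\<close>
  have lim: "(\<lambda>r. \<P>(\<omega> in M. card (P \<omega> \<inter> ball 0 (real r)) = N)) \<longlonglongrightarrow> 0" for N
  proof -
    have "(\<lambda>r. m r ^ N / exp (m r) / fact N) \<longlonglongrightarrow> 0 / fact N"
      by (intro tendsto_divide tendsto_const filterlim_compose[OF tendsto_power_div_exp_0 m]) auto
    moreover have "\<P>(\<omega> in M. card (P \<omega> \<inter> ball 0 (real r)) = N) = m r ^ N / exp (m r) / fact N" for r
      using homogeneous_poisson_processD(2)[OF P, of "ball 0 (real r)" N] by (simp add: m_def exp_minus field_simps)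
    ultimately show ?thesis by simp
  qed
  \<comment> \<open>Constancy from \<open>r0\<close> on implies the event of count \<open>N\<close>
    at every \<open>r \<ge> r0\<close>, and the probabilities of these events tend to 0.\<close>
  have "AE \<omega> in M. \<not> (\<forall>r\<ge>r0. card (P \<omega> \<inter> ball 0 (real r)) = N)" for r0 N
  proof -
    have [measurable]: "(\<lambda>\<omega>. card (P \<omega> \<inter> ball 0 (real r))) \<in> M \<rightarrow>\<^sub>M count_space UNIV" for r
      by (intro point_process_count[OF pp]) auto
    let ?F = "{\<omega>\<in>space M. \<forall>r\<ge>r0. card (P \<omega> \<inter> ball 0 (real r)) = N}"
    have F: "?F \<in> events" by measurable
    have "prob ?F \<le> \<P>(\<omega> in M. card (P \<omega> \<inter> ball 0 (real r)) = N)" if "r \<ge> r0" for r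
      using that by (intro finite_measure_mono) auto
    then have "prob ?F \<le> 0"
      by (intro LIMSEQ_le_const[OF lim[of N]]) blast
    then have "prob ?F = 0"
      using measure_nonneg[of M ?F] by linarith
    then have "?F \<in> null_sets M"
      using F by (simp add: null_sets_def emeasure_eq_measure)
    then show ?thesis
      by (rule AE_I') auto
  qed
  then have "AE \<omega> in M. \<forall>r0 N. \<not> (\<forall>r\<ge>r0. card (P \<omega> \<inter> ball 0 (real r)) = N)"
    by (simp add: AE_all_countable)
  then show ?thesis
  proof (rule AE_mp, intro AE_I2 impI notI)
    fix \<omega> assume *: "\<forall>r0 N. \<not> (\<forall>r\<ge>r0. card (P \<omega> \<inter> ball 0 (real r)) = N)" and "finite (P \<omega>)"
    then have "bounded (P \<omega>)" by (simp add: finite_imp_bounded)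
    then obtain b where b: "\<And>x. x \<in> P \<omega> \<Longrightarrow> norm x \<le> b" by (auto simp: bounded_iff)
    obtain r0 :: nat where r0: "b < real r0" using reals_Archimedean2 by blast
    have "P \<omega> \<inter> ball 0 (real r) = P \<omega>" if "r \<ge> r0" for r
      using b r0 that by fastforce
    then have "\<forall>r\<ge>r0. card (P \<omega> \<inter> ball 0 (real r)) = card (P \<omega>)" by simp
    with * show False by blast
  qed
qed

subsection \<open>The sequence of the mobiles\<close>

text \<open>The uniform probability is a quotient of volumes of sections of measurable sets in the
  product of sequence space and plane, and such volumes depend measurably on the sequence.\<close>

lemma measurable_uniform_voronoi:
  fixes A :: "'b::euclidean_space set"
  assumes A[measurable]: "A \<in> sets borel"
    and f[measurable]: "f \<in> borel_measurable (\<Pi>\<^sub>M k\<in>UNIV :: nat set. borel :: 'b measure)"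
  shows "(\<lambda>y. measure (uniform_measure lborel (voronoi_cell (range y) (f y))) A)
    \<in> borel_measurable (\<Pi>\<^sub>M k\<in>UNIV. borel)"
proof -
  let ?B = "\<Pi>\<^sub>M k\<in>UNIV :: nat set. borel :: 'b measure"
  have V: "voronoi_cell T z \<in> sets borel" for T and z :: 'b
    by (intro borel_closed closed_voronoi_cell)
  have *: "(\<lambda>y. emeasure lborel (voronoi_cell (range y) (f y) \<inter> C)) \<in> borel_measurable ?B"
    if [measurable]: "C \<in> sets borel" for C
  proof -
    \<comment> \<open>Its section over \<open>y\<close> is the cell intersected with
      \<open>C\<close>. As the stations form a sequence, the cell is described by countably many
      conditions.\<close>
    let ?Q = "{w \<in> space (?B \<Otimes>\<^sub>M lborel). (\<forall>k. dist (snd w) (f (fst w)) \<le> dist (snd w) (fst w k)) \<and> snd w \<in> C}"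
    have [measurable]: "(\<lambda>w. fst w k) \<in> borel_measurable (?B \<Otimes>\<^sub>M lborel)" for k
      by (rule measurable_compose[OF measurable_fst]) simp
    have [measurable]: "(\<lambda>w. f (fst w)) \<in> borel_measurable (?B \<Otimes>\<^sub>M lborel)"
      by (rule measurable_compose[OF measurable_fst f])
    have "?Q \<in> sets (?B \<Otimes>\<^sub>M lborel)"
      by measurable
    then have "(\<lambda>y. emeasure lborel (Pair y -` ?Q)) \<in> borel_measurable ?B"
      by (rule lborel.measurable_emeasure_Pair)
    moreover have eq: "Pair y -` ?Q = voronoi_cell (range y) (f y) \<inter> C" for y
      by (auto simp: voronoi_cell_def space_pair_measure space_PiM)
    ultimately show ?thesis by (simp only: eq)
  qed
  have "measure (uniform_measure lborel (voronoi_cell (range y) (f y))) A =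
      enn2real (emeasure lborel (voronoi_cell (range y) (f y) \<inter> A) / emeasure lborel (voronoi_cell (range y) (f y) \<inter> UNIV))" for y
    using V by (simp add: measure_def)
  moreover have "(\<lambda>y. enn2real (emeasure lborel (voronoi_cell (range y) (f y) \<inter> A) / emeasure lborel (voronoi_cell (range y) (f y) \<inter> UNIV)))
      \<in> borel_measurable ?B"
    by (intro borel_measurable_enn2real borel_measurable_divide_ennreal *) auto
  ultimately show ?thesis by simp
qed

text \<open>Many \<open>q k\<close> may isolate the same station, and the default value repeats the
  origin. With infinitely many stations \<open>dedup\<close> leaves each exactly once, as needed for
  the joint law of their mobiles.\<close>

definition station_seq :: "(nat \<Rightarrow> 'b::zero set) \<Rightarrow> 'b set \<Rightarrow> nat \<Rightarrow> 'b" where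
  "station_seq q S = dedup (points q S)"

text \<open>The outage event for an enumeration of the stations: \<open>v n\<close> is the mobile of the \<open>n\<close>-th term, and
  \<open>D\<close> is the set of the indices of first occurrences, so that on the null event of finitely many
  stations no station is counted twice.\<close>
definition outage_seq :: "real \<Rightarrow> real \<Rightarrow> nat \<Rightarrow> nat set \<Rightarrow> (nat \<Rightarrow> real^2) \<Rightarrow> bool" where
  "outage_seq \<alpha> \<theta> K D v \<longleftrightarrow>
     ennreal (norm (v 0) powr - \<alpha>) /
       (\<Sum>n. if n \<in> D - ({0} \<union> K_nearest K (\<lambda>n. norm (v n)) (D - {0})) then ennreal (norm (v n) powr - \<alpha>) else 0)
     < ennreal \<theta>"

text \<open>Restricted to first occurrences, \<open>e\<close> is a bijection onto the stations that
  sends 0 to the origin. The canceled set and the interference sum are transported along it.\<close>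

lemma outage_eq_outage_seq:
  assumes S: "S = range e" and e0: "e 0 = 0" and D: "D = {n. \<forall>m<n. e m \<noteq> e n}"
  shows "outage \<alpha> \<theta> K 1 S u \<longleftrightarrow> outage_seq \<alpha> \<theta> K D (\<lambda>n. u (e n))"
proof -
  have inj: "inj_on e D"
    unfolding D by (rule linorder_inj_onI) (auto simp: eq_commute)
  have "0 \<in> D" by (simp add: D)
  have "e n \<in> e ` D" for n
  proof (induction n rule: less_induct)
    case (less n)
    show ?case
    proof (cases "n \<in> D")
      case False
      then obtain m where "m < n" "e m = e n" by (auto simp: D)
      with less.IH[of m] show ?thesis by simp
    qed blast
  qed
  then have S: "S = e ` D" using S by blast
  have diff: "e ` A - e ` B = e ` (A - B)" if "A \<subseteq> D" "B \<subseteq> D" for A B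
    using inj_on_image_set_diff[OF inj, of A B] that by auto
  have inj': "inj_on e T" if "T \<subseteq> D" for T
    using inj that by (rule inj_on_subset)
  let ?K = "K_nearest K (\<lambda>n. norm (u (e n))) (D - {0})"
  have K: "?K \<subseteq> D" by (auto simp: K_nearest_def)
  have S0: "S - {0} = e ` (D - {0})"
    using diff[of D "{0}"] \<open>0 \<in> D\<close> by (simp add: S e0)
  have "K_nearest K (\<lambda>y. norm (u y)) (S - {0}) = e ` ?K"
    unfolding S0 by (simp add: K_nearest_image[OF inj'] o_def)
  then have "S - ({0} \<union> K_nearest K (\<lambda>y. norm (u y)) (S - {0})) = e ` D - e ` ({0} \<union> ?K)"
    by (simp add: S e0)
  also have "\<dots> = e ` (D - ({0} \<union> ?K))"
    using \<open>0 \<in> D\<close> K by (intro diff) auto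
  finally have far: "S - ({0} \<union> K_nearest K (\<lambda>y. norm (u y)) (S - {0})) = e ` (D - ({0} \<union> ?K))" .
  have "interference \<alpha> 1 K S u = (\<Sum>\<^sub>\<infinity>n\<in>D - ({0} \<union> ?K). ennreal (norm (u (e n)) powr - \<alpha>))"
    unfolding interference_def far by (subst infsum_reindex) (auto intro!: inj' simp: o_def)
  then show ?thesis
    by (simp add: outage_def outage_seq_def infsum_nat_eq_suminf e0)
qed

lemma measurable_outage_seq:
  assumes [measurable]: "\<And>n. Measurable.pred M (\<lambda>\<omega>. n \<in> D \<omega>)"
    and [measurable]: "\<And>n. (\<lambda>\<omega>. v \<omega> n) \<in> borel_measurable M"
  shows "Measurable.pred M (\<lambda>\<omega>. outage_seq \<alpha> \<theta> K (D \<omega>) (v \<omega>))"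
proof -
  \<comment> \<open>Being among the \<open>K\<close> nearest is turned into countably many
    measurable conditions.\<close>
  have near: "n \<in> K_nearest K (\<lambda>n. norm (v \<omega> n)) (D \<omega> - {0}) \<longleftrightarrow>
      (n \<in> D \<omega> \<and> n \<noteq> 0) \<and>
      (\<forall>N. (\<Sum>m<N. of_bool ((m \<in> D \<omega> \<and> m \<noteq> 0) \<and> norm (v \<omega> m) < norm (v \<omega> n)) :: nat) < K)" for n \<omega>
    using finite_card_less_iff_initial_segments[of "{m \<in> D \<omega> - {0}. norm (v \<omega> m) < norm (v \<omega> n)}" K]
    by (simp add: K_nearest_def)
  have [measurable]: "Measurable.pred M (\<lambda>\<omega>. n \<in> K_nearest K (\<lambda>n. norm (v \<omega> n)) (D \<omega> - {0}))" for n
    unfolding near of_bool_def by measurable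
  show ?thesis
    unfolding outage_seq_def Diff_iff Un_iff by measurable
qed

section \<open>Networks with enumerated stations\<close>

locale enumerated_network = cellular_network M l P U + separating_sequence q
  for M :: "'a measure" and l P U and q :: "nat \<Rightarrow> (real^2) set"
begin

abbreviation stations :: "'a \<Rightarrow> (real^2) set" where
  "stations \<omega> \<equiv> insert 0 (P \<omega>)"

lemma stations: "point_process M stations"
  using homogeneous_poisson_processD(1)[OF poisson] by (rule point_process_insert)

lemma subalgebra_stations: "subalgebra M (process_algebra M stations)"
  using stations by (rule subalgebra_process_algebra)

lemma range_points_stations: "\<omega> \<in> space M \<Longrightarrow> range (points q (stations \<omega>)) = stations \<omega>"
  using stations by (intro range_points) (auto simp: point_process_def)

lemma range_station_seq: "\<omega> \<in> space M \<Longrightarrow> range (station_seq q (stations \<omega>)) = stations \<omega>"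
  by (simp add: station_seq_def range_dedup range_points_stations)

lemma station_seq_0: "station_seq q S 0 = 0"
  by (simp add: station_seq_def dedup_0 points_0)

text \<open>Makes the assumption on the conditional law of the mobiles applicable to the enumerated
  stations.\<close>

lemma selection_station_seq: "selection M stations (\<lambda>\<omega>. station_seq q (stations \<omega>) n)"
  unfolding selection_def
proof
  show "(\<lambda>\<omega>. station_seq q (stations \<omega>) n) \<in> borel_measurable (process_algebra M stations)"
    unfolding station_seq_def by (rule measurable_compose[OF measurable_points[OF stations] measurable_dedup])
  show "\<forall>\<omega>\<in>space M. station_seq q (stations \<omega>) n \<in> stations \<omega>"
    using range_station_seq by blast
qed

lemma measurable_station_seq [measurable]: "(\<lambda>\<omega>. station_seq q (stations \<omega>) n) \<in> borel_measurable M"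
  using selection_station_seq[of n] unfolding selection_def
  by (intro measurable_from_subalg[OF subalgebra_stations]) (rule conjunct1)

lemma measurable_mobile [measurable]: "(\<lambda>\<omega>. U \<omega> (station_seq q (stations \<omega>) n)) \<in> borel_measurable M"
  using mobiles selection_station_seq unfolding independent_uniform_mobiles_def by blast

lemma measurable_points_M: "(\<lambda>\<omega>. points q (stations \<omega>)) \<in> M \<rightarrow>\<^sub>M (\<Pi>\<^sub>M k\<in>UNIV. borel)"
  by (rule measurable_from_subalg[OF subalgebra_stations measurable_points[OF stations]])

lemma AE_inj_station_seq: "AE \<omega> in M. inj (station_seq q (stations \<omega>))"
  using AE_infinite_poisson[OF prob_space_axioms poisson density_pos] AE_space
  by eventually_elim (simp add: station_seq_def inj_dedup range_points_stations)

text \<open>The probability is the integral of the conditional probability given the stations. This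
  is almost surely a function of the sequence \<open>points\<close> alone, whose range is the
  station set, so the result depends on the network only through the law of that sequence.\<close>

lemma prob_mobiles:
  fixes n :: nat
  assumes A: "\<And>i. i < n \<Longrightarrow> A i \<in> sets borel"
  shows "prob {\<omega>\<in>space M. \<forall>i<n. U \<omega> (station_seq q (stations \<omega>) i) \<in> A i} =
    (\<integral>y. (\<Prod>i<n. measure (uniform_measure lborel (voronoi_cell (range y) (dedup y i))) (A i))
      \<partial>distr M (\<Pi>\<^sub>M k\<in>UNIV. borel) (\<lambda>\<omega>. points q (stations \<omega>)))"
proof -
  let ?E = "{\<omega>\<in>space M. \<forall>i<n. U \<omega> (station_seq q (stations \<omega>) i) \<in> A i}"
  let ?G = "\<lambda>y. \<Prod>i<n. measure (uniform_measure lborel (voronoi_cell (range y) (dedup y i))) (A i)"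
  interpret finite_measure_subalgebra M "process_algebra M stations"
    by unfold_locales (rule subalgebra_stations)
  have E: "?E \<in> events"
  proof -
    have "{\<omega>\<in>space M. \<forall>i\<in>{..<n}. U \<omega> (station_seq q (stations \<omega>) i) \<in> A i} \<in> events"
    proof (intro sets.sets_Collect_finite_All)
      fix i assume "i \<in> {..<n}"
      then have [measurable]: "A i \<in> sets borel" using A by simp
      show "{\<omega>\<in>space M. U \<omega> (station_seq q (stations \<omega>) i) \<in> A i} \<in> events" by measurable
    qed simp
    then show ?thesis by (simp only: lessThan_iff Ball_def)
  qed
  have G: "?G \<in> borel_measurable (\<Pi>\<^sub>M k\<in>UNIV. borel)"
    using A by (intro borel_measurable_prod measurable_uniform_voronoi measurable_dedup) auto
  have "AE \<omega> in M. inj_on (\<lambda>i. station_seq q (stations \<omega>) i) {..<n} \<longrightarrow>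
      real_cond_exp M (process_algebra M stations) (indicator ?E) \<omega> =
      (\<Prod>i<n. measure (uniform_measure lborel (voronoi_cell (stations \<omega>) (station_seq q (stations \<omega>) i))) (A i))"
    using mobiles[unfolded independent_uniform_mobiles_def, THEN conjunct2, rule_format,
        of n "\<lambda>i \<omega>. station_seq q (stations \<omega>) i" A] selection_station_seq A by blast
  \<comment> \<open>The stations are almost surely distinct, which discharges the injectivity
    condition in the assumption on the mobiles.\<close>
  with AE_inj_station_seq AE_space
  have "AE \<omega> in M. real_cond_exp M (process_algebra M stations) (indicator ?E) \<omega> = ?G (points q (stations \<omega>))"
  proof eventually_elim
    case (elim \<omega>)
    then have "inj_on (\<lambda>i. station_seq q (stations \<omega>) i) {..<n}"
      by (auto intro: inj_on_subset)
    with elim show ?case by (simp add: range_points_stations station_seq_def)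
  qed
  then have "(\<integral>\<omega>. real_cond_exp M (process_algebra M stations) (indicator ?E) \<omega> \<partial>M) =
      (\<integral>\<omega>. ?G (points q (stations \<omega>)) \<partial>M)"
    by (intro integral_cong_AE measurable_compose[OF measurable_points_M G] borel_measurable_cond_exp2)
  moreover have "(\<integral>\<omega>. real_cond_exp M (process_algebra M stations) (indicator ?E) \<omega> \<partial>M) = prob ?E"
  proof -
    have "emeasure M X < \<infinity>" for X
      by (simp add: emeasure_eq_measure)
    then have int: "integrable M (indicator ?E :: 'a \<Rightarrow> real)"
      by (rule integrable_real_indicator[OF E])
    have "?E \<inter> space M = ?E" by blast
    then show ?thesis
      unfolding real_cond_exp_int(2)[OF int] Bochner_Integration.integral_indicator by (rule arg_cong)
  qed
  ultimately show ?thesis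
    by (simp add: integral_distr[OF measurable_points_M G])
qed

lemma outage_probability_eq_mobiles:
  "outage_probability M P U \<alpha> \<theta> K 1 =
    measure (distr M (\<Pi>\<^sub>M n\<in>UNIV. borel) (\<lambda>\<omega> n. U \<omega> (station_seq q (stations \<omega>) n)))
      {v \<in> space (\<Pi>\<^sub>M n\<in>UNIV. borel). outage_seq \<alpha> \<theta> K UNIV v}"
proof -
  let ?D = "\<lambda>\<omega>. {n. \<forall>m<n. station_seq q (stations \<omega>) m \<noteq> station_seq q (stations \<omega>) n}"
  let ?v = "\<lambda>\<omega> n. U \<omega> (station_seq q (stations \<omega>) n)"
  let ?B = "\<Pi>\<^sub>M n\<in>UNIV :: nat set. borel :: (real^2) measure"
  have v: "?v \<in> M \<rightarrow>\<^sub>M ?B"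
    by (rule measurable_PiM_single') auto
  have "Measurable.pred M (\<lambda>\<omega>. n \<in> ?D \<omega>)" for n
  proof -
    have "Measurable.pred M (\<lambda>\<omega>. \<forall>m\<in>{..<n}. station_seq q (stations \<omega>) m \<noteq> station_seq q (stations \<omega>) n)"
    proof (rule pred_intros_finite(3)[OF finite_lessThan])
      fix m
      have "{\<omega>\<in>space M. station_seq q (stations \<omega>) m = station_seq q (stations \<omega>) n} \<in> events"
        by (rule measurable_equality_set) (rule measurable_station_seq)+
      then have "Measurable.pred M (\<lambda>\<omega>. station_seq q (stations \<omega>) m = station_seq q (stations \<omega>) n)"
        by (simp only: pred_def)
      then show "Measurable.pred M (\<lambda>\<omega>. station_seq q (stations \<omega>) m \<noteq> station_seq q (stations \<omega>) n)"
        by (rule pred_intros_logic)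
    qed
    then show ?thesis by simp
  qed
  then have meas: "Measurable.pred M (\<lambda>\<omega>. outage_seq \<alpha> \<theta> K (?D \<omega>) (?v \<omega>))"
    by (intro measurable_outage_seq measurable_mobile)
  have meas': "Measurable.pred ?B (\<lambda>v. outage_seq \<alpha> \<theta> K UNIV v)"
    by (rule measurable_outage_seq) simp_all
  have meas'': "Measurable.pred M (\<lambda>\<omega>. outage_seq \<alpha> \<theta> K UNIV (?v \<omega>))"
    using v meas' by (rule measurable_compose)
  \<comment> \<open>With the random index set \<open>?D\<close> the two events coincide for every
    outcome. Only the following replacement of \<open>?D\<close> by \<open>UNIV\<close> is almost
    sure.\<close>
  have "outage_probability M P U \<alpha> \<theta> K 1 = \<P>(\<omega> in M. outage_seq \<alpha> \<theta> K (?D \<omega>) (?v \<omega>))"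
    unfolding outage_probability_eq
    using range_station_seq station_seq_0
    by (intro arg_cong[where f="measure M"] Collect_cong conj_cong refl outage_eq_outage_seq) auto
  also have "\<dots> = \<P>(\<omega> in M. outage_seq \<alpha> \<theta> K UNIV (?v \<omega>))"
  proof (rule measure_eq_AE)
    show "AE \<omega> in M. \<omega> \<in> {\<omega>\<in>space M. outage_seq \<alpha> \<theta> K (?D \<omega>) (?v \<omega>)} \<longleftrightarrow>
        \<omega> \<in> {\<omega>\<in>space M. outage_seq \<alpha> \<theta> K UNIV (?v \<omega>)}"
      using AE_inj_station_seq
    proof eventually_elim
      case (elim \<omega>)
      then have "?D \<omega> = UNIV" by (auto dest: injD)
      then show ?case by simp
    qed
  qed (use meas meas'' in \<open>simp_all only: pred_def\<close>)
  also have "\<dots> = measure (distr M ?B ?v) {v \<in> space ?B. outage_seq \<alpha> \<theta> K UNIV v}"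
    using meas' measurable_space[OF v]
    by (subst measure_distr[OF v]) (auto simp: pred_def intro!: arg_cong[where f="measure M"])
  finally show ?thesis .
qed

end

section \<open>Comparison of two networks\<close>

lemma outage_probability_same_density:
  fixes M :: "'a measure" and M' :: "'b measure"
  assumes "cellular_network M l P U" "cellular_network M' l P' U'"
  shows "outage_probability M P U \<alpha> \<theta> K 1 = outage_probability M' P' U' \<alpha> \<theta> K 1"
proof -
  \<comment> \<open>Both networks are enumerated with the same \<open>q\<close>, so that their
    enumerations have the same law.\<close>
  obtain q :: "nat \<Rightarrow> (real^2) set" where q: "separating_sequence q"
    using separating_sequence_exists by blast
  interpret N: enumerated_network M l P U q
    using assms(1) q by (rule enumerated_network.intro)
  interpret N': enumerated_network M' l P' U' q
    using assms(2) q by (rule enumerated_network.intro)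
  let ?B = "\<Pi>\<^sub>M n\<in>UNIV :: nat set. borel :: (real^2) measure"
  have prob_eq: "N.prob {\<omega>\<in>space M. \<forall>i<n. U \<omega> (station_seq q (insert 0 (P \<omega>)) i) \<in> A i} =
      N'.prob {\<omega>\<in>space M'. \<forall>i<n. U' \<omega> (station_seq q (insert 0 (P' \<omega>)) i) \<in> A i}"
    if A: "\<And>i. i < n \<Longrightarrow> A i \<in> sets borel" for n A
  proof -
    have points: "distr M ?B (\<lambda>\<omega>. points q (insert 0 (P \<omega>))) = distr M' ?B (\<lambda>\<omega>. points q (insert 0 (P' \<omega>)))"
      by (rule N.distr_points_eq[OF N.prob_space_axioms N'.prob_space_axioms N.poisson N'.poisson])
    show ?thesis
      using N.prob_mobiles[of n A, OF A] N'.prob_mobiles[of n A, OF A] unfolding points by metis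
  qed
  have "distr M ?B (\<lambda>\<omega> n. U \<omega> (station_seq q (insert 0 (P \<omega>)) n)) =
      distr M' ?B (\<lambda>\<omega> n. U' \<omega> (station_seq q (insert 0 (P' \<omega>)) n))"
  proof (rule distr_PiM_UNIV_eqI[OF N.prob_space_axioms])
    show "(\<lambda>\<omega> n. U \<omega> (station_seq q (insert 0 (P \<omega>)) n)) \<in> M \<rightarrow>\<^sub>M ?B"
      by (rule measurable_PiM_single') (auto intro: N.measurable_mobile)
    show "(\<lambda>\<omega> n. U' \<omega> (station_seq q (insert 0 (P' \<omega>)) n)) \<in> M' \<rightarrow>\<^sub>M ?B"
      by (rule measurable_PiM_single') (auto intro: N'.measurable_mobile)
    fix J :: "nat set" and A :: "nat \<Rightarrow> (real^2) set"
    assume J: "finite J" and A: "\<And>i. i \<in> J \<Longrightarrow> A i \<in> sets borel"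
    obtain n where n: "J \<subseteq> {..<n}" using finite_nat_bounded[OF J] by blast
    \<comment> \<open>The mobile law is known on initial segments; indices outside \<open>J\<close>
      receive the trivial condition \<open>UNIV\<close>.\<close>
    define A' where "A' i = (if i \<in> J then A i else UNIV)" for i
    have A': "A' i \<in> sets borel" for i using A by (simp add: A'_def)
    have cyl: "(\<forall>i\<in>J. v i \<in> A i) \<longleftrightarrow> (\<forall>i<n. v i \<in> A' i)" for v :: "nat \<Rightarrow> real^2"
      using n by (auto simp: A'_def)
    show "emeasure M {\<omega>\<in>space M. \<forall>i\<in>J. U \<omega> (station_seq q (insert 0 (P \<omega>)) i) \<in> A i} =
        emeasure M' {\<omega>\<in>space M'. \<forall>i\<in>J. U' \<omega> (station_seq q (insert 0 (P' \<omega>)) i) \<in> A i}"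
      unfolding cyl N.emeasure_eq_measure N'.emeasure_eq_measure prob_eq[OF A'] ..
  qed
  then show ?thesis
    unfolding N.outage_probability_eq_mobiles N'.outage_probability_eq_mobiles by simp
qed

text \<open>Equality for two arbitrary networks covers changes of density and power, and also shows
  that the outage probability does not depend on the chosen realization of the model.\<close>

theorem proposition2:
  fixes \<alpha> \<theta> p p' l l' :: real and K :: nat
    and M :: "'a measure" and M' :: "'b measure"
    and P :: "'a \<Rightarrow> (real^2) set" and P' :: "'b \<Rightarrow> (real^2) set"
    and U :: "'a \<Rightarrow> real^2 \<Rightarrow> real^2" and U' :: "'b \<Rightarrow> real^2 \<Rightarrow> real^2"
  assumes "\<alpha> > 2" and "\<theta> > 0" and "p > 0" and "p' > 0"
    and "cellular_network M l P U" and "cellular_network M' l' P' U'"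
  shows "outage_probability M P U \<alpha> \<theta> K p = outage_probability M' P' U' \<alpha> \<theta> K p'"
proof -
  interpret N: cellular_network M l P U by fact
  interpret N': cellular_network M' l' P' U' by fact
  \<comment> \<open>Scaling by \<open>c\<close> divides the density by the square of
    \<open>c\<close>, so the square roots bring both densities to 1.\<close>
  let ?c = "sqrt l" and ?c' = "sqrt l'"
  have c: "?c > 0" "?c' > 0" using N.density_pos N'.density_pos by simp_all
  have net: "cellular_network M 1 (\<lambda>\<omega>. (*\<^sub>R) ?c ` P \<omega>) (\<lambda>\<omega> y. ?c *\<^sub>R U \<omega> (y /\<^sub>R ?c))"
    using N.scale[OF c(1)] N.density_pos by simp
  have net': "cellular_network M' 1 (\<lambda>\<omega>. (*\<^sub>R) ?c' ` P' \<omega>) (\<lambda>\<omega> y. ?c' *\<^sub>R U' \<omega> (y /\<^sub>R ?c'))"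
    using N'.scale[OF c(2)] N'.density_pos by simp
  have "outage_probability M P U \<alpha> \<theta> K p = outage_probability M P U \<alpha> \<theta> K 1"
    unfolding outage_probability_eq outage_power[OF \<open>p > 0\<close>] ..
  also have "\<dots> = outage_probability M' P' U' \<alpha> \<theta> K 1"
    using outage_probability_same_density[OF net net', of \<alpha> \<theta> K]
    unfolding N.outage_probability_scale[OF c(1) zero_less_one]
      N'.outage_probability_scale[OF c(2) zero_less_one] .
  also have "\<dots> = outage_probability M' P' U' \<alpha> \<theta> K p'"
    unfolding outage_probability_eq outage_power[OF \<open>p' > 0\<close>] ..
  finally show ?thesis .
qed

end
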